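(* Let $\xi$ be a real random variable and define $\varepsilon(x)=1+e^x\ln\mathbb P(\xi\le x)\in[-\infty,1]$. Assume that $\lim_{x\to+\infty}\varepsilon(x)=0$ and that there is $\delta>0$ with $\varepsilon(x)\in[-\delta^{-1},1-\delta]$ for all $x\in\mathbb R$. For each $N\ge 1$, let $\{\xi_{i,j}(s):1\le i,j\le N,\ s\ge 1\}$ be i.i.d. with the law of $\xi$, let $X(0)\in\mathbb R^N$ be an arbitrary initial configuration, and define $X_i(t+1)=\max_{1\le j\le N}\{X_j(t)+\xi_{i,j}(t+1)\}$ for $1\le i\le N$, $t\ge 0$. Let $\Phi(x)=\ln\sum_{j=1}^N e^{x_j}$ and $U_N(t,x)=N^{-1}\sum_{i=1}^N \mathbf 1_{X_i(t)>x}$. Then for all choices of initial configurations, all $k\ge 1$, all $K_N\subset\{1,\dots,N\}$ of cardinality $k$, and all $t\ge 2$, $$\big(X_j(t)-\Phi(X(t-1));\ j\in K_N\big)\ \longrightarrow\ G(0,1)^{\otimes k}\quad\text{in law as }N\to\infty,$$ where $G(0,1)$ is the standard Gumbel law with distribution function $\exp(-e^{-x})$; and moreover $$U_N\big(t,\Phi(X(t-1))+x\big)\longrightarrow u(x)=1-e^{-e^{-x}}$$ uniformly in $x\in\mathbb R$, in probability, as $N\to\infty$. *)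

theory Defs
  imports "HOL-Probability.Probability"
begin

definition cdf_of :: "real measure \<Rightarrow> real \<Rightarrow> real" where
  "cdf_of \<mu> x = measure \<mu> {..x}"

definition eps_of :: "real measure \<Rightarrow> real \<Rightarrow> ereal" where
  "eps_of \<mu> x = (if cdf_of \<mu> x = 0 then -\<infinity> else ereal (1 + exp x * ln (cdf_of \<mu> x)))"

fun maxplus :: "nat \<Rightarrow> (nat \<Rightarrow> real) \<Rightarrow> (nat \<Rightarrow> nat \<Rightarrow> nat \<Rightarrow> real) \<Rightarrow> nat \<Rightarrow> nat \<Rightarrow> real" where
  "maxplus N x0 xi 0 i = x0 i"
| "maxplus N x0 xi (Suc t) i = (MAX j\<in>{1..N}. maxplus N x0 xi t j + xi i j (Suc t))"

definition Phi :: "nat \<Rightarrow> (nat \<Rightarrow> real) \<Rightarrow> real" where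
  "Phi N x = ln (\<Sum>j=1..N. exp (x j))"

definition U_emp :: "nat \<Rightarrow> (nat \<Rightarrow> real) \<Rightarrow> real \<Rightarrow> real" where
  "U_emp N x y = card {i\<in>{1..N}. x i > y} / real N"

definition gumbel :: "real measure" where
  "gumbel = interval_measure (\<lambda>x. exp (- exp (- x)))"

definition conv_in_law :: "(nat \<Rightarrow> 'a measure) \<Rightarrow> (nat \<Rightarrow> 'a \<Rightarrow> ('k \<Rightarrow> real)) \<Rightarrow> ('k \<Rightarrow> real) measure \<Rightarrow> bool" where
  "conv_in_law M Y L \<longleftrightarrow>
     (\<forall>f :: ('k \<Rightarrow> real) \<Rightarrow> real. continuous_on UNIV f \<and> bounded (range f) \<longrightarrow>
        ((\<lambda>N. \<integral>\<omega>. f (Y N \<omega>) \<partial>M N) \<longlongrightarrow> (\<integral>y. f y \<partial>L)) sequentially)"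

end

theory Submission
  imports Defs "HOL-Real_Asymp.Real_Asymp"
begin

text \<open>From a fixed front \<open>v\<close>, one step produces independent values with common distribution function
  \<open>\<Prod>j. F (x - v j)\<close>. Centred at \<open>Phi v\<close> and written with the weights \<open>w j = exp (v j - Phi v)\<close>, which sum
  to 1, this is \<open>exp (- exp (- x) * (1 - (\<Sum>j. w j * \<epsilon> (x - ln (w j)))))\<close>, so it is close to the Gumbel law
  as soon as all weights are small. The bounds on \<open>\<epsilon>\<close> give the exponentials of the centred values tails
  of order \<open>1 / y\<close>: among \<open>N\<close> of them the maximum is of order \<open>N\<close>, while the sum is much larger than
  \<open>N\<close>. Hence a single step, from whatever front, already makes all weights small with high
  probability, and the next step is then asymptotically Gumbel; this is why \<open>t \<ge> 2\<close> is needed.\<close>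

section \<open>One step from a fixed front\<close>

text \<open>A single step need not give the Gumbel law: when one coordinate of the front dominates,
  the centred step is close to a copy of the passage variable itself. Since the initial
  configurations are arbitrary and may change with \<open>N\<close>, every estimate of a step has to
  be uniform in the front, so thresholds for \<open>N\<close> are chosen before \<open>v\<close>.
  The sum of the exponentials exceeds any multiple of \<open>N\<close> because a tail of order
  \<open>1 / y\<close> has a truncated mean that diverges logarithmically: each dyadic level up to
  \<open>2 ^ K\<close> adds a fixed amount. Cutting at a \<open>K\<close> that does not depend on
  \<open>N\<close> keeps the summands bounded, so that Hoeffding's inequality applies. Consecutive
  steps are glued by Fubini's theorem, and what is lost there is the probability of a front with a
  large weight.\<close>

definition max_step :: "nat \<Rightarrow> (nat \<Rightarrow> real) \<Rightarrow> (nat \<times> nat \<Rightarrow> real) \<Rightarrow> nat \<Rightarrow> real" where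
  "max_step N v w i = (MAX j\<in>{1..N}. v j + w (i, j))"

definition noise :: "real measure \<Rightarrow> nat \<Rightarrow> (nat \<times> nat \<Rightarrow> real) measure" where
  "noise \<mu> N = Pi\<^sub>M ({1..N} \<times> {1..N}) (\<lambda>_. \<mu>)"

definition step_cdf :: "real measure \<Rightarrow> nat \<Rightarrow> (nat \<Rightarrow> real) \<Rightarrow> real \<Rightarrow> real" where
  "step_cdf \<mu> N v x = (\<Prod>j=1..N. cdf \<mu> (x - v j))"

context real_distribution
begin

lemma prob_space_noise: "prob_space (noise M N)"
  unfolding noise_def by (rule prob_space_PiM) unfold_locales

lemma sets_noise: "sets (noise M N) = sets (Pi\<^sub>M ({1..N} \<times> {1..N}) (\<lambda>_. borel))"
  unfolding noise_def by (intro sets_PiM_cong) simp_all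

lemma noise_coordinate_measurable:
  "p \<in> {1..N} \<times> {1..N} \<Longrightarrow> (\<lambda>w. w p) \<in> borel_measurable (noise M N)"
  by (subst measurable_cong_sets[OF sets_noise refl]) (rule measurable_component_singleton)

lemma indep_vars_noise:
  assumes "N \<ge> 1"
  shows "prob_space.indep_vars (noise M N) (\<lambda>_. borel) (\<lambda>p w. w p) ({1..N} \<times> {1..N})"
proof -
  interpret Q: prob_space "noise M N" by (rule prob_space_noise)
  let ?I = "{1..N} \<times> {1..N}"
  have comp: "distr (noise M N) borel (\<lambda>w. w p) = M" if "p \<in> ?I" for p
  proof -
    have "distr (noise M N) M (\<lambda>w. w p) = M"
      unfolding noise_def
      by (rule distr_PiM_component) (use that prob_space_axioms in auto)
    then show ?thesis
      by (metis distr_cong sets_eq_imp_space_eq events_eq_borel)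
  qed
  have "distr (noise M N) (Pi\<^sub>M ?I (\<lambda>_. borel)) (\<lambda>w. restrict w ?I)
      = distr (noise M N) (noise M N) (\<lambda>w. w)"
    by (intro distr_cong) (auto simp: sets_noise, auto simp: noise_def space_PiM)
  also have "\<dots> = Pi\<^sub>M ?I (\<lambda>p. distr (noise M N) borel (\<lambda>w. w p))"
    unfolding distr_id2[OF refl] by (subst noise_def) (rule PiM_cong, simp_all add: comp)
  finally show ?thesis
    using assms by (subst Q.indep_vars_iff_distr_eq_PiM') (auto intro: noise_coordinate_measurable)
qed

lemma max_step_measurable:
  assumes "i \<in> {1..N}"
  shows "(\<lambda>w. max_step N v w i) \<in> borel_measurable (noise M N)"
  unfolding max_step_def using assms
  by (intro borel_measurable_Max borel_measurable_add noise_coordinate_measurable) auto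

text \<open>The site \<open>\<kappa> a\<close> reads only its own row of passage times, and
  injectivity makes the rows disjoint. The index map has two uses: the identity on all sites for
  Hoeffding's inequality, and the choice of the finitely many observed sites.\<close>

lemma indep_vars_max_step:
  assumes "N \<ge> 1" "inj_on \<kappa> L" "\<kappa> ` L \<subseteq> {1..N}"
  shows "prob_space.indep_vars (noise M N) (\<lambda>_. borel) (\<lambda>a w. max_step N v w (\<kappa> a)) L"
proof -
  interpret Q: prob_space "noise M N" by (rule prob_space_noise)
  let ?K = "\<lambda>a. {\<kappa> a} \<times> {1..N}"
  have "Q.indep_vars (\<lambda>a. Pi\<^sub>M (?K a) (\<lambda>_. borel)) (\<lambda>a w. restrict (\<lambda>p. w p) (?K a)) L"
    by (intro Q.indep_vars_restrict[OF indep_vars_noise])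
       (use assms in \<open>auto simp: disjoint_family_on_def inj_on_def\<close>)
  then have "Q.indep_vars (\<lambda>_. borel) (\<lambda>a w. (\<lambda>z. MAX j\<in>{1..N}. v j + z (\<kappa> a, j)) (restrict (\<lambda>p. w p) (?K a))) L"
    by (rule Q.indep_vars_compose2)
       (intro borel_measurable_Max borel_measurable_add borel_measurable_const
          measurable_component_singleton, use assms in auto)
  then show ?thesis
    by (simp add: max_step_def cong: image_cong_simp)
qed

text \<open>A maximum is at most \<open>x\<close> iff every entry of row \<open>i\<close> lies below
  its own threshold; this is a box, so the product measure factorises.\<close>

lemma measure_max_step_le:
  assumes "i \<in> {1..N}"
  shows "measure (noise M N) {w \<in> space (noise M N). max_step N v w i \<le> x} = step_cdf M N v x"
proof -
  interpret P: product_prob_space "\<lambda>_. M" "{1..N} \<times> {1..N}" by unfold_locales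
  interpret Q: prob_space "noise M N" by (rule prob_space_noise)
  let ?J = "{i} \<times> {1..N}"
  have "{w \<in> space (noise M N). max_step N v w i \<le> x}
      = {w \<in> space (noise M N). \<forall>p\<in>?J. w p \<in> {..x - v (snd p)}}"
    using assms by (auto simp: max_step_def field_simps)
  also have "emeasure (noise M N) \<dots> = (\<Prod>p\<in>?J. emeasure M {..x - v (snd p)})"
    unfolding noise_def by (rule P.emeasure_PiM_Collect) (use assms in auto)
  also have "\<dots> = (\<Prod>j=1..N. ennreal (cdf M (x - v j)))"
    by (rule prod.reindex_bij_witness[of _ "Pair i" snd]) (auto simp: cdf_def emeasure_eq_measure)
  also have "\<dots> = ennreal (step_cdf M N v x)"
    by (simp add: step_cdf_def prod_ennreal cdf_nonneg)
  finally show ?thesis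
    by (simp add: Q.emeasure_eq_measure step_cdf_def prod_nonneg cdf_nonneg)
qed

end

section \<open>Weights of the front\<close>

definition weight :: "nat \<Rightarrow> (nat \<Rightarrow> real) \<Rightarrow> nat \<Rightarrow> real" where
  "weight N v j = exp (v j - Phi N v)"

lemma sum_exp_pos:
  fixes v :: "nat \<Rightarrow> real"
  shows "N \<ge> 1 \<Longrightarrow> (\<Sum>j=1..N. exp (v j)) > 0"
  by (intro sum_pos) auto

lemma weight_eq: "N \<ge> 1 \<Longrightarrow> weight N v j = exp (v j) / (\<Sum>i=1..N. exp (v i))"
  using sum_exp_pos[of N v] by (simp add: weight_def Phi_def exp_diff)

lemma sum_weight: "N \<ge> 1 \<Longrightarrow> (\<Sum>j=1..N. weight N v j) = 1"
  using sum_exp_pos[of N v] by (simp add: weight_eq flip: sum_divide_distrib)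

section \<open>The tail error of the passage law and its average over a front\<close>

locale gumbel_tail = real_distribution \<mu> for \<mu> :: "real measure" +
  fixes \<delta> :: real
  assumes delta_pos: "\<delta> > 0"
    and eps_lim: "((\<lambda>x. eps_of \<mu> x) \<longlongrightarrow> 0) at_top"
    and eps_bounds: "\<And>x. - ereal (1 / \<delta>) \<le> eps_of \<mu> x \<and> eps_of \<mu> x \<le> ereal (1 - \<delta>)"
begin

definition err :: "real \<Rightarrow> real" where
  "err x = 1 + exp x * ln (cdf \<mu> x)"

text \<open>A zero of the distribution function would make \<open>eps_of\<close> equal to
  -\<infinity>, below the assumed lower bound. Hence the real-valued \<open>err\<close> can replace
  \<open>eps_of\<close> from here on.\<close>

lemma cdf_pos: "cdf \<mu> x > 0"
proof (rule ccontr)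
  assume "\<not> cdf \<mu> x > 0"
  then have "cdf_of \<mu> x = 0"
    using cdf_nonneg[of x] by (simp add: cdf_def cdf_of_def not_less antisym)
  then show False
    using eps_bounds[of x] by (simp add: eps_of_def)
qed

lemma eps_of_eq_err: "eps_of \<mu> x = ereal (err x)"
  using cdf_pos[of x] by (simp add: eps_of_def err_def cdf_def cdf_of_def)

lemma err_lower: "- (1 / \<delta>) \<le> err x" and err_upper: "err x \<le> 1 - \<delta>"
  using eps_bounds[of x] by (simp_all add: eps_of_eq_err)

lemma err_lim: "(err \<longlongrightarrow> 0) at_top"
  using eps_lim by (simp add: eps_of_eq_err zero_ereal_def)

lemma cdf_eq_err: "cdf \<mu> x = exp (- (exp (- x) * (1 - err x)))"
proof -
  have "exp (- x) * (1 - err x) = - (exp (- x) * exp x * ln (cdf \<mu> x))"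
    by (simp add: err_def)
  also have "\<dots> = - ln (cdf \<mu> x)"
    by (simp flip: exp_add)
  finally show ?thesis
    using cdf_pos[of x] by simp
qed

text \<open>A convex combination of values of \<open>err\<close>. The argument
  \<open>Phi N v + x - v j\<close> is \<open>x - ln (weight N v j)\<close>, so a small weight
  evaluates \<open>err\<close> far to the right.\<close>

definition avg_err :: "nat \<Rightarrow> (nat \<Rightarrow> real) \<Rightarrow> real \<Rightarrow> real" where
  "avg_err N v x = (\<Sum>j=1..N. weight N v j * err (Phi N v + x - v j))"

text \<open>Max-stability of the Gumbel law up to an error: were \<open>err\<close> zero, each
  factor would be a shifted Gumbel distribution function and the exponents would add up
  exactly.\<close>

lemma step_cdf_eq:
  assumes "N \<ge> 1"
  shows "step_cdf \<mu> N v (Phi N v + x) = exp (- (exp (- x) * (1 - avg_err N v x)))"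
proof -
  have "exp (- (Phi N v + x - v j)) = exp (- x) * weight N v j" for j
    by (simp add: weight_def flip: exp_add)
  then have "step_cdf \<mu> N v (Phi N v + x)
      = exp (\<Sum>j=1..N. - (exp (- x) * (weight N v j * (1 - err (Phi N v + x - v j)))))"
    by (simp add: step_cdf_def cdf_eq_err exp_sum mult.assoc)
  also have "(\<Sum>j=1..N. - (exp (- x) * (weight N v j * (1 - err (Phi N v + x - v j)))))
      = - (exp (- x) * ((\<Sum>j=1..N. weight N v j) - avg_err N v x))"
    by (simp add: avg_err_def sum_negf right_diff_distrib sum_subtractf flip: sum_distrib_left)
  finally show ?thesis
    using sum_weight[OF assms] by simp
qed

lemma avg_err_lower:
  assumes "N \<ge> 1" shows "- (1 / \<delta>) \<le> avg_err N v x"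
proof -
  have "- (1 / \<delta>) = (\<Sum>j=1..N. weight N v j * - (1 / \<delta>))"
    unfolding sum_distrib_right[symmetric] using sum_weight[OF assms] by simp
  also have "\<dots> \<le> avg_err N v x"
    unfolding avg_err_def by (intro sum_mono mult_left_mono err_lower) (simp add: weight_def)
  finally show ?thesis .
qed

lemma avg_err_upper:
  assumes "N \<ge> 1" shows "avg_err N v x \<le> 1 - \<delta>"
proof -
  have "avg_err N v x \<le> (\<Sum>j=1..N. weight N v j * (1 - \<delta>))"
    unfolding avg_err_def by (intro sum_mono mult_left_mono err_upper) (simp add: weight_def)
  also have "\<dots> = 1 - \<delta>"
    unfolding sum_distrib_right[symmetric] using sum_weight[OF assms] by simp
  finally show ?thesis .
qed

text \<open>The bounds on \<open>err\<close> survive averaging, so this and the next estimate hold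
  for every front, however unequal its weights.\<close>

lemma step_cdf_lower:
  "N \<ge> 1 \<Longrightarrow> exp (- ((1 + 1 / \<delta>) * exp (- x))) \<le> step_cdf \<mu> N v (Phi N v + x)"
  using avg_err_lower[of N v x] by (simp add: step_cdf_eq mult.commute)

lemma step_cdf_upper:
  "N \<ge> 1 \<Longrightarrow> step_cdf \<mu> N v (Phi N v + x) \<le> exp (- (\<delta> * exp (- x)))"
  using avg_err_upper[of N v x] by (simp add: step_cdf_eq mult.commute)

text \<open>Small weights push every argument of \<open>err\<close> beyond the point after which
  \<open>err\<close> is small. \<open>\<eta>\<close> depends on \<open>x\<close> and
  \<open>e\<close> alone, which gives uniformity in the size and in the front.\<close>

lemma step_cdf_near_gumbel:
  assumes "e > 0"
  obtains \<eta> where "\<eta> > 0"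
    "\<And>N v. N \<ge> 1 \<Longrightarrow> (\<And>j. j \<in> {1..N} \<Longrightarrow> weight N v j \<le> \<eta>) \<Longrightarrow>
       \<bar>step_cdf \<mu> N v (Phi N v + x) - exp (- exp (- x))\<bar> < e"
proof -
  have "isCont (\<lambda>s. exp (- (exp (- x) * (1 - s)))) 0"
    by (intro continuous_intros)
  then obtain d where d: "d > 0"
    "\<And>s. \<bar>s\<bar> < d \<Longrightarrow> \<bar>exp (- (exp (- x) * (1 - s))) - exp (- exp (- x))\<bar> < e"
    using assms unfolding continuous_at_eps_delta by (auto simp: dist_real_def)
  have "eventually (\<lambda>y. \<bar>err y\<bar> < d / 2) at_top"
    using tendstoD[OF err_lim, of "d / 2"] d(1) by (simp add: dist_real_def)
  then obtain z where z: "\<And>y. y \<ge> z \<Longrightarrow> \<bar>err y\<bar> < d / 2"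
    by (auto simp: eventually_at_top_linorder)
  show thesis
  \<comment> \<open>A weight of at most \<open>exp (x - z)\<close> means exactly
    \<open>Phi N v + x - v j \<ge> z\<close>.\<close>
  proof (rule that[of "exp (x - z)"])
    fix N v
    assume N: "N \<ge> (1::nat)" and w: "\<And>j. j \<in> {1..N} \<Longrightarrow> weight N v j \<le> exp (x - z)"
    have "\<bar>avg_err N v x\<bar> \<le> (\<Sum>j=1..N. weight N v j * (d / 2))"
      unfolding avg_err_def
    proof (intro order_trans[OF sum_abs] sum_mono)
      fix j assume "j \<in> {1..N}"
      then have "Phi N v + x - v j \<ge> z"
        using w[of j] by (simp add: weight_def)
      from z[OF this] show "\<bar>weight N v j * err (Phi N v + x - v j)\<bar> \<le> weight N v j * (d / 2)"
        by (simp add: abs_mult weight_def)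
    qed
    also have "\<dots> = d / 2"
      unfolding sum_distrib_right[symmetric] using sum_weight[OF N] by simp
    finally have "\<bar>avg_err N v x\<bar> < d"
      using d(1) by simp
    from d(2)[OF this] show "\<bar>step_cdf \<mu> N v (Phi N v + x) - exp (- exp (- x))\<bar> < e"
      by (simp add: step_cdf_eq[OF N])
  qed simp
qed

lemma measure_max_step_greater:
  assumes "i \<in> {1..N}"
  shows "measure (noise \<mu> N) {w \<in> space (noise \<mu> N). max_step N v w i > x} = 1 - step_cdf \<mu> N v x"
proof -
  interpret Q: prob_space "noise \<mu> N" by (rule prob_space_noise)
  note [measurable] = max_step_measurable[OF assms]
  have "{w \<in> space (noise \<mu> N). max_step N v w i > x}
      = space (noise \<mu> N) - {w \<in> space (noise \<mu> N). max_step N v w i \<le> x}"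
    by auto
  then show ?thesis
    by (simp add: Q.prob_compl measure_max_step_le[OF assms])
qed

end

section \<open>Smallness of the weights after one step\<close>

text \<open>A lower bound for tails that is of the right order for small \<open>u\<close> and still
  usable at the lowest dyadic level, where \<open>u\<close> is \<open>\<delta>\<close>
  itself.\<close>

lemma ge_divide_one_plus:
  assumes "u \<ge> (0::real)"
  shows "u / (1 + u) \<le> 1 - exp (- u)"
proof -
  have "exp (- u) \<le> 1 / (1 + u)"
    using exp_ge_add_one_self[of u] assms by (simp add: exp_minus field_simps)
  also have "\<dots> = 1 - u / (1 + u)"
    using assms by (simp add: field_simps)
  finally show ?thesis by simp
qed

lemma sum_two_powers: "(\<Sum>k<K. 2 ^ k :: real) = 2 ^ K - 1"
  by (induction K) simp_all

context gumbel_tail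
begin

text \<open>A bounded minorant of \<open>2 * exp (y - Phi N v)\<close> whose mean under one step is at least
  proportional to \<open>K\<close>: this quantifies that the exponentials of the step have infinite mean.\<close>

definition dyadic :: "nat \<Rightarrow> nat \<Rightarrow> (nat \<Rightarrow> real) \<Rightarrow> real \<Rightarrow> real" where
  "dyadic K N v y = (\<Sum>k<K. 2 ^ k * indicator {Phi N v + real k * ln 2<..} y)"

lemma dyadic_measurable [measurable]: "dyadic K N v \<in> borel_measurable borel"
  unfolding dyadic_def by measurable

lemma dyadic_bounds: "0 \<le> dyadic K N v y" "dyadic K N v y \<le> 2 ^ K"
proof -
  show "0 \<le> dyadic K N v y"
    unfolding dyadic_def by (intro sum_nonneg) simp
  have "dyadic K N v y \<le> (\<Sum>k<K. 2 ^ k)"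
    unfolding dyadic_def by (intro sum_mono) (simp add: indicator_def)
  then show "dyadic K N v y \<le> 2 ^ K"
    by (simp add: sum_two_powers)
qed

text \<open>If the top level is exceeded, the whole geometric sum is below twice its last term,
  which is below the exponential; otherwise the top term vanishes and the induction hypothesis
  applies.\<close>

lemma dyadic_le_exp: "dyadic K N v y \<le> 2 * exp (y - Phi N v)"
proof (induction K)
  case 0
  then show ?case by (simp add: dyadic_def)
next
  case (Suc K)
  show ?case
  proof (cases "y > Phi N v + real K * ln 2")
    case True
    have "2 ^ K = exp (real K * ln (2::real))"
      by (simp add: exp_of_nat_mult)
    also have "\<dots> \<le> exp (y - Phi N v)"
      using True by simp
    finally have "2 ^ Suc K \<le> 2 * exp (y - Phi N v)"
      by simp
    then show ?thesis
      using dyadic_bounds(2)[of "Suc K" N v y] by linarith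
  next
    case False
    then show ?thesis
      using Suc by (simp add: dyadic_def)
  qed
qed

text \<open>The probability of exceeding level \<open>k\<close> is at least of order
  \<open>1 / 2 ^ k\<close>, which the factor \<open>2 ^ k\<close> cancels: every level contributes
  at least the same constant.\<close>

lemma expectation_dyadic_ge:
  assumes "i \<in> {1..N}"
  shows "real K * (\<delta> / (1 + \<delta>)) \<le> (\<integral>w. dyadic K N v (max_step N v w i) \<partial>noise \<mu> N)"
proof -
  interpret Q: prob_space "noise \<mu> N" by (rule prob_space_noise)
  note [measurable] = max_step_measurable[OF assms]
  have N: "N \<ge> 1" using assms by auto
  let ?E = "\<lambda>k. {w \<in> space (noise \<mu> N). max_step N v w i > Phi N v + real k * ln 2}"
  have "(\<integral>w. dyadic K N v (max_step N v w i) \<partial>noise \<mu> N)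
      = (\<integral>w. (\<Sum>k<K. 2 ^ k * indicator (?E k) w) \<partial>noise \<mu> N)"
    by (intro Bochner_Integration.integral_cong) (auto simp: dyadic_def indicator_def intro!: sum.cong)
  also have "\<dots> = (\<Sum>k<K. 2 ^ k * measure (noise \<mu> N) (?E k))"
    by (subst Bochner_Integration.integral_sum)
       (auto intro!: integrable_mult_right integrable_real_indicator simp: Q.emeasure_eq_measure)
  also have "\<dots> = (\<Sum>k<K. 2 ^ k * (1 - step_cdf \<mu> N v (Phi N v + real k * ln 2)))"
    by (simp add: measure_max_step_greater[OF assms])
  finally have *: "(\<integral>w. dyadic K N v (max_step N v w i) \<partial>noise \<mu> N)
      = (\<Sum>k<K. 2 ^ k * (1 - step_cdf \<mu> N v (Phi N v + real k * ln 2)))" .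
  have "(\<Sum>k<K. \<delta> / (1 + \<delta>)) \<le> (\<Sum>k<K. 2 ^ k * (1 - step_cdf \<mu> N v (Phi N v + real k * ln 2)))"
  proof (rule sum_mono)
    fix k
    let ?u = "\<delta> * exp (- (real k * ln 2))"
    have u: "?u = \<delta> / 2 ^ k"
      by (simp add: exp_minus exp_of_nat_mult field_simps)
    have "\<delta> / (1 + \<delta>) \<le> \<delta> / (1 + ?u)"
      unfolding u using delta_pos
      by (intro divide_left_mono add_left_mono) (auto simp: field_simps intro!: mult_pos_pos add_pos_pos)
    also have "\<dots> = 2 ^ k * (?u / (1 + ?u))"
      unfolding u by simp
    also have "\<dots> \<le> 2 ^ k * (1 - exp (- ?u))"
      using delta_pos by (intro mult_left_mono ge_divide_one_plus) auto
    also have "\<dots> \<le> 2 ^ k * (1 - step_cdf \<mu> N v (Phi N v + real k * ln 2))"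
      using step_cdf_upper[OF N, of v "real k * ln 2"] by (intro mult_left_mono) auto
    finally show "\<delta> / (1 + \<delta>) \<le> 2 ^ k * (1 - step_cdf \<mu> N v (Phi N v + real k * ln 2))" .
  qed
  then show ?thesis
    by (simp add: *)
qed

text \<open>Union bound: by \<open>1 - exp (- u) \<le> u\<close> each site has a tail of at most
  \<open>(1 + 1 / \<delta>) / (real N * a)\<close>, and the \<open>N\<close> sites cancel the
  \<open>N\<close>.\<close>

lemma measure_some_max_step_large:
  assumes "N \<ge> 1" "a > 0"
  shows "measure (noise \<mu> N) (\<Union>i\<in>{1..N}. {w \<in> space (noise \<mu> N). max_step N v w i > Phi N v + ln (real N * a)})
    \<le> (1 + 1 / \<delta>) / a"
proof -
  interpret Q: prob_space "noise \<mu> N" by (rule prob_space_noise)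
  let ?u = "(1 + 1 / \<delta>) * exp (- ln (real N * a))"
  have u: "?u = (1 + 1 / \<delta>) / (real N * a)"
    using assms by (simp add: exp_minus field_simps)
  have "measure (noise \<mu> N) (\<Union>i\<in>{1..N}. {w \<in> space (noise \<mu> N). max_step N v w i > Phi N v + ln (real N * a)})
    \<le> (\<Sum>i=1..N. measure (noise \<mu> N) {w \<in> space (noise \<mu> N). max_step N v w i > Phi N v + ln (real N * a)})"
    by (intro measure_UNION_le) (auto intro!: borel_measurable_less max_step_measurable)
  also have "\<dots> = (\<Sum>i=1..N. 1 - step_cdf \<mu> N v (Phi N v + ln (real N * a)))"
    by (intro sum.cong measure_max_step_greater) auto
  also have "\<dots> \<le> (\<Sum>i=1..N. ?u)"
  proof (rule sum_mono)
    show "1 - step_cdf \<mu> N v (Phi N v + ln (real N * a)) \<le> ?u"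
      using step_cdf_lower[OF assms(1), of "ln (real N * a)" v] exp_ge_add_one_self[of "- ?u"]
      by linarith
  qed
  also have "\<dots> = (1 + 1 / \<delta>) / a"
    unfolding u using assms by simp
  finally show ?thesis .
qed

text \<open>A weight is one exponential over the sum of all. Two rare events are excluded: an
  exponential above \<open>real N * a\<close>, and a sum of dyadic minorants well below its mean.
  The quantifier over \<open>v\<close> stands inside the eventuality because the bound is later
  applied to a random front that changes with \<open>N\<close>.\<close>

lemma weights_of_max_step_small:
  assumes "\<eta> > 0" "e > 0"
  shows "\<forall>\<^sub>F N in sequentially. \<forall>v. measure (noise \<mu> N)
    {w \<in> space (noise \<mu> N). \<exists>j\<in>{1..N}. weight N (max_step N v w) j > \<eta>} \<le> e"
proof -
  \<comment> \<open>\<open>a\<close> makes the union bound equal to \<open>e / 2\<close>;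
    \<open>A\<close> is chosen so that an exponential of at most \<open>real N * a\<close> over a
    sum above \<open>A * real N\<close> gives the ratio \<open>\<eta>\<close>.\<close>
  define a where "a = 2 * (1 + 1 / \<delta>) / e"
  define A where "A = a / \<eta>"
  have a: "a > 0" "(1 + 1 / \<delta>) / a = e / 2" and A: "A > 0" "a / A = \<eta>"
  proof -
    define c where "c = 1 + 1 / \<delta>"
    have "c > 0"
      using delta_pos by (simp add: c_def add_pos_pos)
    then show "a > 0" "(1 + 1 / \<delta>) / a = e / 2"
      using assms by (simp_all add: a_def flip: c_def)
    then show "A > 0" "a / A = \<eta>"
      using assms by (simp_all add: A_def)
  qed
  \<comment> \<open>A mean of \<open>3 * A\<close> per site: one \<open>A\<close> is given up as
    Hoeffding deviation, and the other two are halved by the factor 2 in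
    \<open>dyadic_le_exp\<close>, which leaves \<open>A\<close>.\<close>
  obtain K :: nat where K: "real K * (\<delta> / (1 + \<delta>)) \<ge> 3 * A"
    using real_arch_simple[of "3 * A / (\<delta> / (1 + \<delta>))"] delta_pos by (auto simp: field_simps)
  have "(\<lambda>N. exp (- (2 * A\<^sup>2 / (2 ^ K)\<^sup>2) * real N)) \<longlonglongrightarrow> 0"
    using A(1) by real_asymp
  then have "\<forall>\<^sub>F N in sequentially. exp (- (2 * A\<^sup>2 / (2 ^ K)\<^sup>2) * real N) < e / 2"
    using assms by (intro order_tendstoD) auto
  then show ?thesis
    using eventually_ge_at_top[of 1]
  proof (eventually_elim, intro allI)
    fix N v
    assume N: "N \<ge> (1::nat)" and small: "exp (- (2 * A\<^sup>2 / (2 ^ K)\<^sup>2) * real N) < e / 2"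
    interpret Q: prob_space "noise \<mu> N" by (rule prob_space_noise)
    let ?Z = "\<lambda>i w. dyadic K N v (max_step N v w i)"
    let ?m = "\<Sum>i=1..N. \<integral>w. ?Z i w \<partial>noise \<mu> N"
    let ?A = "\<Union>i\<in>{1..N}. {w \<in> space (noise \<mu> N). max_step N v w i > Phi N v + ln (real N * a)}"
    let ?B = "{w \<in> space (noise \<mu> N). (\<Sum>i=1..N. ?Z i w) \<le> ?m - real N * A}"
    note [measurable] = max_step_measurable[of _ N]
    \<comment> \<open>The range \<open>2 ^ K\<close> was fixed before \<open>N\<close>, so the
      exponent in Hoeffding's inequality is linear in \<open>N\<close>.\<close>
    interpret H: Hoeffding_ineq "noise \<mu> N" "{1..N}" ?Z "\<lambda>_. 0" "\<lambda>_. 2 ^ K" ?m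
    proof (unfold_locales)
      show "Q.indep_vars (\<lambda>_. borel) ?Z {1..N}"
        using indep_vars_max_step[OF N, of "\<lambda>i. i" "{1..N}"]
        by (rule Q.indep_vars_compose2) auto
    qed (auto simp: dyadic_bounds)
    have [measurable]: "?A \<in> sets (noise \<mu> N)" "?B \<in> sets (noise \<mu> N)"
      by measurable
    have m: "3 * A * real N \<le> ?m"
    proof -
      have "(\<Sum>i=1..N. 3 * A) \<le> ?m"
        by (intro sum_mono order_trans[OF K] expectation_dyadic_ge) auto
      then show ?thesis by (simp add: mult.commute)
    qed
    have sub: "{w \<in> space (noise \<mu> N). \<exists>j\<in>{1..N}. weight N (max_step N v w) j > \<eta>} \<subseteq> ?A \<union> ?B"
    proof (rule ccontr)
      assume "\<not> ?thesis"
      then obtain w j where w: "w \<in> space (noise \<mu> N)" "j \<in> {1..N}"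
        and big: "weight N (max_step N v w) j > \<eta>" and nA: "w \<notin> ?A" and nB: "w \<notin> ?B"
        by blast
      \<comment> \<open>Weights do not change when a front is shifted, so the new front may be
        centred at \<open>Phi N v\<close>, where the tail estimates hold.\<close>
      let ?Y = "\<lambda>i. exp (max_step N v w i - Phi N v)"
      have "max_step N v w j \<le> Phi N v + ln (real N * a)"
        using w nA by fastforce
      then have "?Y j \<le> exp (ln (real N * a))"
        by simp
      then have Yj: "?Y j \<le> real N * a"
        using N a by simp
      have "2 * A * real N \<le> ?m - real N * A"
        using m by (simp add: algebra_simps)
      also have "\<dots> < (\<Sum>i=1..N. ?Z i w)"
        using nB w(1) by (simp add: not_le)
      also have "\<dots> \<le> (\<Sum>i=1..N. 2 * ?Y i)"
        by (intro sum_mono dyadic_le_exp)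
      finally have sumY: "A * real N < (\<Sum>i=1..N. ?Y i)"
        by (simp add: sum_distrib_left[symmetric])
      have "weight N (max_step N v w) j = ?Y j / (\<Sum>i=1..N. ?Y i)"
        by (simp add: weight_eq[OF N] exp_diff sum_divide_distrib[symmetric])
      also have "\<dots> \<le> (real N * a) / (A * real N)"
        using Yj sumY A(1) a(1) N by (intro frac_le) auto
      also have "\<dots> = \<eta>"
        using A N by simp
      finally show False
        using big by simp
    qed
    have "measure (noise \<mu> N) ?B \<le> exp (- 2 * (real N * A)\<^sup>2 / (\<Sum>i=1..N. (2 ^ K - 0)\<^sup>2))"
      by (rule H.Hoeffding_ineq_le) (use A N in auto)
    also have "\<dots> = exp (- (2 * A\<^sup>2 / (2 ^ K)\<^sup>2) * real N)"
      using N by (simp add: field_simps power2_eq_square)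
    finally have B: "measure (noise \<mu> N) ?B \<le> e / 2"
      using small by simp
    have "measure (noise \<mu> N) {w \<in> space (noise \<mu> N). \<exists>j\<in>{1..N}. weight N (max_step N v w) j > \<eta>}
        \<le> measure (noise \<mu> N) (?A \<union> ?B)"
      by (intro Q.finite_measure_mono sub) measurable
    also have "\<dots> \<le> measure (noise \<mu> N) ?A + measure (noise \<mu> N) ?B"
      by (intro measure_Un_le) measurable
    also have "\<dots> \<le> e / 2 + e / 2"
      using measure_some_max_step_large[OF N a(1), of v] a(2) B by (intro add_mono) auto
    finally show "measure (noise \<mu> N)
      {w \<in> space (noise \<mu> N). \<exists>j\<in>{1..N}. weight N (max_step N v w) j > \<eta>} \<le> e"
      by simp
  qed
qed

end

section \<open>The Gumbel limit of one step\<close>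

lemma
  shows gumbel_cdf_mono: "x \<le> y \<Longrightarrow> exp (- exp (- x)) \<le> exp (- exp (- y :: real))"
    and gumbel_cdf_right_cont: "continuous (at_right x) (\<lambda>x. exp (- exp (- x :: real)))"
    and gumbel_cdf_at_bot: "((\<lambda>x. exp (- exp (- x :: real))) \<longlongrightarrow> 0) at_bot"
    and gumbel_cdf_at_top: "((\<lambda>x. exp (- exp (- x :: real))) \<longlongrightarrow> 1) at_top"
  by (simp, intro continuous_intros, real_asymp, real_asymp)

lemma real_distribution_gumbel: "real_distribution gumbel"
  unfolding gumbel_def
  by (intro real_distribution_interval_measure gumbel_cdf_mono gumbel_cdf_right_cont
        gumbel_cdf_at_bot gumbel_cdf_at_top)

lemma cdf_gumbel: "cdf gumbel = (\<lambda>x. exp (- exp (- x)))"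
  unfolding gumbel_def
  by (intro cdf_interval_measure gumbel_cdf_mono gumbel_cdf_right_cont gumbel_cdf_at_bot)

lemma borel_measurable_continuous_PiM:
  fixes f :: "('k::finite \<Rightarrow> real) \<Rightarrow> real"
  assumes "continuous_on UNIV f"
  shows "f \<in> borel_measurable (Pi\<^sub>M UNIV (\<lambda>_. borel))"
  by (subst measurable_cong_sets[OF sets_PiM_equal_borel refl])
     (rule borel_measurable_continuous_onI[OF assms])

text \<open>Skorohod's representation is used in each coordinate separately, on a power of the
  representing space, so that only the one-dimensional theorem is needed.\<close>

lemma weak_conv_PiM:
  fixes f :: "('k::finite \<Rightarrow> real) \<Rightarrow> real"
  assumes \<nu>: "\<And>n. real_distribution (\<nu> n)" and \<nu>': "real_distribution \<nu>'"
    and conv: "weak_conv_m \<nu> \<nu>'"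
    and f: "continuous_on UNIV f" "bounded (range f)"
  shows "(\<lambda>n. \<integral>y. f y \<partial>Pi\<^sub>M UNIV (\<lambda>_. \<nu> n)) \<longlonglongrightarrow> (\<integral>y. f y \<partial>Pi\<^sub>M UNIV (\<lambda>_. \<nu>'))"
proof -
  obtain \<Omega> :: "real measure" and Y_seq Y where \<Omega>: "prob_space \<Omega>"
    and Y_seq [measurable]: "\<And>n. Y_seq n \<in> borel_measurable \<Omega>" "\<And>n. distr \<Omega> borel (Y_seq n) = \<nu> n"
    and Y [measurable]: "Y \<in> borel_measurable \<Omega>" "distr \<Omega> borel Y = \<nu>'"
    and lim: "\<And>x. x \<in> space \<Omega> \<Longrightarrow> (\<lambda>n. Y_seq n x) \<longlonglongrightarrow> Y x"
    using Skorohod[OF \<nu> \<nu>' conv] unfolding measurable_lborel1 by blast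
  interpret \<Omega>: prob_space \<Omega> by fact
  let ?P = "Pi\<^sub>M UNIV (\<lambda>_::'k. \<Omega>)"
  interpret P: prob_space ?P by (intro prob_space_PiM \<Omega>)
  note [measurable] = borel_measurable_continuous_PiM[OF f(1)]
  obtain B where B: "\<And>y. \<bar>f y\<bar> \<le> B"
    using f(2) by (auto simp: bounded_iff)
  have meas: "(\<lambda>\<omega> (a::'k). X (\<omega> a)) \<in> measurable ?P (Pi\<^sub>M UNIV (\<lambda>_. borel))"
    if [measurable]: "X \<in> borel_measurable \<Omega>" for X
    by (intro measurable_PiM_single') (auto intro: measurable_compose[OF measurable_component_singleton])
  have law: "(\<integral>y. f y \<partial>Pi\<^sub>M UNIV (\<lambda>_. distr \<Omega> borel X)) = (\<integral>\<omega>. f (\<lambda>a. X (\<omega> a)) \<partial>?P)"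
    if [measurable]: "X \<in> borel_measurable \<Omega>" for X
  proof -
    let ?D = "distr \<Omega> borel X"
    \<comment> \<open>The two target sigma-algebras agree, but the theorem on componentwise maps
      expects the one built from \<open>?D\<close>.\<close>
    have "distr ?P (Pi\<^sub>M UNIV (\<lambda>_. borel)) (compose UNIV X) = distr ?P (Pi\<^sub>M UNIV (\<lambda>_. ?D)) (compose UNIV X)"
      by (intro distr_cong sets_PiM_cong) simp_all
    also have "\<dots> = Pi\<^sub>M UNIV (\<lambda>_. distr \<Omega> ?D X)"
      by (rule distr_PiM_finite_prob_space') (auto intro: \<Omega> \<Omega>.prob_space_distr)
    also have "distr \<Omega> ?D X = ?D"
      by (rule distr_cong) simp_all
    finally have "distr ?P (Pi\<^sub>M UNIV (\<lambda>_. borel)) (compose UNIV X) = Pi\<^sub>M UNIV (\<lambda>_. ?D)" .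
    moreover have "compose UNIV X = (\<lambda>\<omega> (a::'k). X (\<omega> a))"
      by (simp add: compose_def fun_eq_iff)
    ultimately have "Pi\<^sub>M UNIV (\<lambda>_. distr \<Omega> borel X)
        = distr ?P (Pi\<^sub>M UNIV (\<lambda>_. borel)) (\<lambda>\<omega> (a::'k). X (\<omega> a))"
      by simp
    then show ?thesis
      by (simp add: integral_distr[OF meas[OF that]])
  qed
  have "(\<lambda>n. \<integral>\<omega>. f (\<lambda>a. Y_seq n (\<omega> a)) \<partial>?P) \<longlonglongrightarrow> (\<integral>\<omega>. f (\<lambda>a. Y (\<omega> a)) \<partial>?P)"
  proof (rule integral_dominated_convergence[where w = "\<lambda>_. B"])
    show "AE \<omega> in ?P. (\<lambda>n. f (\<lambda>a. Y_seq n (\<omega> a))) \<longlonglongrightarrow> f (\<lambda>a. Y (\<omega> a))"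
    proof (intro AE_I2)
      fix \<omega> assume "\<omega> \<in> space ?P"
      \<comment> \<open>Coordinatewise convergence is convergence in the product topology, to which
        the continuity of \<open>f\<close> refers.\<close>
      then have "(\<lambda>n. \<lambda>a. Y_seq n (\<omega> a)) \<longlonglongrightarrow> (\<lambda>a. Y (\<omega> a))"
        unfolding limitin_canonical_iff[symmetric] euclidean_product_topology[symmetric]
        by (subst limitin_componentwise) (auto simp: space_PiM intro!: lim)
      then show "(\<lambda>n. f (\<lambda>a. Y_seq n (\<omega> a))) \<longlonglongrightarrow> f (\<lambda>a. Y (\<omega> a))"
        using f(1) by (intro isCont_tendsto_compose[of _ f]) (auto simp: continuous_on_eq_continuous_at)
    qed
    show "(\<lambda>\<omega>. f (\<lambda>a. Y (\<omega> a))) \<in> borel_measurable ?P"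
      by (rule measurable_compose[OF meas]) measurable
    show "(\<lambda>\<omega>. f (\<lambda>a. Y_seq n (\<omega> a))) \<in> borel_measurable ?P" for n
      by (rule measurable_compose[OF meas]) measurable
  qed (simp_all add: B)
  then show ?thesis
    using law[OF Y(1)] law[OF Y_seq(1)] by (simp only: Y(2) Y_seq(2))
qed

lemma U_emp_eq: "U_emp N u y = (\<Sum>i=1..N. indicator {y<..} (u i)) / real N"
proof -
  have "real (card {i\<in>{1..N}. u i > y}) = (\<Sum>i=1..N. indicator {y<..} (u i))"
    by (simp add: indicator_def sum.If_cases Int_def)
  then show ?thesis
    by (simp add: U_emp_def)
qed

context gumbel_tail
begin

text \<open>The observed sites are independent with one common law, so their joint law is a power of
  it. This reduces the joint limit to convergence of one distribution function.\<close>

lemma indep_max_step_law: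
  fixes \<kappa> :: "'k::finite \<Rightarrow> nat" and f :: "('k \<Rightarrow> real) \<Rightarrow> real"
  assumes \<kappa>: "inj \<kappa>" "range \<kappa> \<subseteq> {1..N}" and f: "continuous_on UNIV f"
  obtains \<nu> where "real_distribution \<nu>" "\<And>x. cdf \<nu> x = step_cdf \<mu> N v (Phi N v + x)"
    "(\<integral>w. f (\<lambda>a. max_step N v w (\<kappa> a) - Phi N v) \<partial>noise \<mu> N) = (\<integral>y. f y \<partial>Pi\<^sub>M UNIV (\<lambda>_. \<nu>))"
proof -
  interpret Q: prob_space "noise \<mu> N" by (rule prob_space_noise)
  note [measurable] = borel_measurable_continuous_PiM[OF f]
  have \<kappa>_in: "\<kappa> a \<in> {1..N}" for a using \<kappa>(2) by blast
  have N: "N \<ge> 1" using \<kappa>_in[of undefined] by auto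
  let ?X = "\<lambda>a w. max_step N v w (\<kappa> a) - Phi N v"
  let ?\<nu> = "\<lambda>a. distr (noise \<mu> N) borel (?X a)"
  have [measurable]: "?X a \<in> borel_measurable (noise \<mu> N)" for a
    using max_step_measurable[OF \<kappa>_in] by measurable
  have rd: "real_distribution (?\<nu> a)" for a
    by (rule Q.real_distribution_distr) measurable
  have cdf: "cdf (?\<nu> a) x = step_cdf \<mu> N v (Phi N v + x)" for a x
  proof -
    have "cdf (?\<nu> a) x = measure (noise \<mu> N) {w \<in> space (noise \<mu> N). max_step N v w (\<kappa> a) \<le> Phi N v + x}"
      unfolding cdf_def by (subst measure_distr) (auto intro!: arg_cong[where f = "measure _"])
    then show ?thesis
      by (simp add: measure_max_step_le[OF \<kappa>_in])
  qed
  \<comment> \<open>A law is determined by its distribution function; \<open>undefined\<close>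
    serves as an arbitrary index.\<close>
  have same: "?\<nu> a = ?\<nu> undefined" for a
    by (rule cdf_unique[OF rd rd]) (simp add: fun_eq_iff cdf)
  have "Q.indep_vars (\<lambda>_. borel) ?X UNIV"
    by (rule Q.indep_vars_compose2[OF indep_vars_max_step[OF N, of \<kappa> UNIV]]) (use \<kappa> in auto)
  then have "distr (noise \<mu> N) (Pi\<^sub>M UNIV (\<lambda>_. borel)) (\<lambda>w a. ?X a w) = Pi\<^sub>M UNIV ?\<nu>"
    by (subst (asm) Q.indep_vars_iff_distr_eq_PiM) (simp_all add: restrict_UNIV)
  also have "\<dots> = Pi\<^sub>M UNIV (\<lambda>_. ?\<nu> undefined)"
    by (rule PiM_cong[OF refl same])
  finally have "distr (noise \<mu> N) (Pi\<^sub>M UNIV (\<lambda>_. borel)) (\<lambda>w a. ?X a w) = Pi\<^sub>M UNIV (\<lambda>_. ?\<nu> undefined)" .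
  then have "(\<integral>y. f y \<partial>Pi\<^sub>M UNIV (\<lambda>_. ?\<nu> undefined))
      = (\<integral>y. f y \<partial>distr (noise \<mu> N) (Pi\<^sub>M UNIV (\<lambda>_. borel)) (\<lambda>w a. ?X a w))"
    by simp
  also have "\<dots> = (\<integral>w. f (\<lambda>a. ?X a w) \<partial>noise \<mu> N)"
    by (rule integral_distr) (auto intro!: measurable_PiM_single')
  finally show thesis
    by (intro that[OF rd[of undefined] cdf]) simp
qed

text \<open>Uniformity by contradiction: failure for every \<open>\<eta>\<close> yields sizes,
  fronts and index maps along which all weights tend to 0 while the deviation stays at least
  \<open>e\<close>. Along this sequence the distribution functions converge to the Gumbel one, so
  \<open>weak_conv_PiM\<close> makes the deviation vanish.\<close>

lemma max_step_law_near_gumbel: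
  fixes f :: "('k::finite \<Rightarrow> real) \<Rightarrow> real"
  assumes f: "continuous_on UNIV f" "bounded (range f)" and "e > 0"
  shows "\<exists>\<eta>>0. \<forall>N v \<kappa>. inj \<kappa> \<longrightarrow> range \<kappa> \<subseteq> {1..N} \<longrightarrow> (\<forall>j\<in>{1..N}. weight N v j \<le> \<eta>) \<longrightarrow>
       \<bar>(\<integral>w. f (\<lambda>a. max_step N v w (\<kappa> a) - Phi N v) \<partial>noise \<mu> N)
         - (\<integral>y. f y \<partial>Pi\<^sub>M UNIV (\<lambda>_. gumbel))\<bar> < e"
proof (rule ccontr)
  let ?D = "\<lambda>N v \<kappa>. \<bar>(\<integral>w. f (\<lambda>a. max_step N v w (\<kappa> a) - Phi N v) \<partial>noise \<mu> N)
         - (\<integral>y. f y \<partial>Pi\<^sub>M UNIV (\<lambda>_. gumbel))\<bar>"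
  assume neg: "\<not> ?thesis"
  have "\<exists>N v \<kappa>. inj \<kappa> \<and> range \<kappa> \<subseteq> {1..N} \<and> (\<forall>j\<in>{1..N}. weight N v j \<le> 1 / Suc n) \<and> \<not> ?D N v \<kappa> < e"
    for n :: nat
  proof (rule ccontr)
    assume "\<not> ?thesis"
    moreover have "1 / real (Suc n) > 0" by simp
    ultimately show False
      using neg by blast
  qed
  then obtain N v \<kappa> where \<kappa>: "\<And>n. inj (\<kappa> n)" "\<And>n. range (\<kappa> n) \<subseteq> {1..N n}"
    and w: "\<And>n j. j \<in> {1..N n} \<Longrightarrow> weight (N n) (v n) j \<le> 1 / Suc n"
    and far: "\<And>n. \<not> ?D (N n) (v n) (\<kappa> n) < e"
    by metis
  have N: "N n \<ge> 1" for n
    using \<kappa>(2)[of n] by fastforce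
  have "\<exists>\<nu>. real_distribution \<nu> \<and> (\<forall>x. cdf \<nu> x = step_cdf \<mu> (N n) (v n) (Phi (N n) (v n) + x)) \<and>
    (\<integral>w. f (\<lambda>a. max_step (N n) (v n) w (\<kappa> n a) - Phi (N n) (v n)) \<partial>noise \<mu> (N n))
      = (\<integral>y. f y \<partial>Pi\<^sub>M UNIV (\<lambda>_. \<nu>))" for n
    by (rule indep_max_step_law[OF \<kappa> f(1), of n "v n"]) blast
  then obtain \<nu> where \<nu>: "\<And>n. real_distribution (\<nu> n)"
    "\<And>n x. cdf (\<nu> n) x = step_cdf \<mu> (N n) (v n) (Phi (N n) (v n) + x)"
    "\<And>n. (\<integral>w. f (\<lambda>a. max_step (N n) (v n) w (\<kappa> n a) - Phi (N n) (v n)) \<partial>noise \<mu> (N n))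
      = (\<integral>y. f y \<partial>Pi\<^sub>M UNIV (\<lambda>_. \<nu> n))"
    by metis
  have "(\<lambda>n. cdf (\<nu> n) x) \<longlonglongrightarrow> cdf gumbel x" for x
  proof (rule tendstoI)
    fix r :: real assume "r > 0"
    then obtain \<eta> where \<eta>: "\<eta> > 0"
      "\<And>N v. N \<ge> 1 \<Longrightarrow> (\<And>j. j \<in> {1..N} \<Longrightarrow> weight N v j \<le> \<eta>) \<Longrightarrow>
         \<bar>step_cdf \<mu> N v (Phi N v + x) - exp (- exp (- x))\<bar> < r"
      using step_cdf_near_gumbel[of r x] by metis
    have "(\<lambda>n. 1 / real (Suc n)) \<longlonglongrightarrow> 0" by real_asymp
    then have "\<forall>\<^sub>F n in sequentially. 1 / real (Suc n) < \<eta>"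
      using \<eta>(1) by (rule order_tendstoD)
    then show "\<forall>\<^sub>F n in sequentially. dist (cdf (\<nu> n) x) (cdf gumbel x) < r"
    proof eventually_elim
      case (elim n)
      then have "weight (N n) (v n) j \<le> \<eta>" if "j \<in> {1..N n}" for j
        using w[OF that] by simp
      from \<eta>(2)[OF N this] show ?case
        by (simp add: \<nu>(2) cdf_gumbel dist_real_def)
    qed
  qed
  then have "weak_conv_m \<nu> gumbel"
    by (simp add: weak_conv_m_def weak_conv_def)
  from weak_conv_PiM[OF \<nu>(1) real_distribution_gumbel this f]
  have "\<forall>\<^sub>F n in sequentially. ?D (N n) (v n) (\<kappa> n) < e"
    using \<open>e > 0\<close> by (auto simp: \<nu>(3) tendsto_iff dist_real_def)
  then show False
    using far by (auto simp: eventually_sequentially)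
qed

text \<open>Bias and fluctuation: small weights bring the mean of \<open>U_emp\<close> within
  \<open>e / 2\<close> of the Gumbel tail, and Hoeffding's inequality for indicators controls the
  rest. \<open>\<eta>\<close> is fixed before \<open>e'\<close>, on which only the threshold for
  \<open>N\<close> depends.\<close>

lemma U_emp_max_step_near_gumbel:
  assumes "e > 0"
  obtains \<eta> where "\<eta> > 0"
    "\<And>e'. e' > 0 \<Longrightarrow> \<forall>\<^sub>F N in sequentially. \<forall>v. (\<forall>j\<in>{1..N}. weight N v j \<le> \<eta>) \<longrightarrow>
       measure (noise \<mu> N) {w \<in> space (noise \<mu> N).
         \<bar>U_emp N (max_step N v w) (Phi N v + x) - (1 - exp (- exp (- x)))\<bar> > e} \<le> e'"
proof -
  obtain \<eta> where \<eta>: "\<eta> > 0"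
    "\<And>N v. N \<ge> 1 \<Longrightarrow> (\<And>j. j \<in> {1..N} \<Longrightarrow> weight N v j \<le> \<eta>) \<Longrightarrow>
       \<bar>step_cdf \<mu> N v (Phi N v + x) - exp (- exp (- x))\<bar> < e / 2"
    using step_cdf_near_gumbel[of "e / 2" x] assms by auto
  show thesis
  proof (rule that[OF \<eta>(1)])
    fix e' :: real assume "e' > 0"
    have "(\<lambda>N. 2 * exp (- (e\<^sup>2 / 2) * real N)) \<longlonglongrightarrow> 0"
      using assms by real_asymp
    then have "\<forall>\<^sub>F N in sequentially. 2 * exp (- (e\<^sup>2 / 2) * real N) < e'"
      using \<open>e' > 0\<close> by (rule order_tendstoD)
    then show "\<forall>\<^sub>F N in sequentially. \<forall>v. (\<forall>j\<in>{1..N}. weight N v j \<le> \<eta>) \<longrightarrow>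
       measure (noise \<mu> N) {w \<in> space (noise \<mu> N).
         \<bar>U_emp N (max_step N v w) (Phi N v + x) - (1 - exp (- exp (- x)))\<bar> > e} \<le> e'"
      using eventually_ge_at_top[of 1]
    proof (eventually_elim, intro allI impI)
      fix N v
      assume small: "2 * exp (- (e\<^sup>2 / 2) * real N) < e'" and N: "N \<ge> (1::nat)"
        and w: "\<forall>j\<in>{1..N}. weight N v j \<le> \<eta>"
      interpret Q: prob_space "noise \<mu> N" by (rule prob_space_noise)
      let ?Z = "\<lambda>i w. indicator {Phi N v + x<..} (max_step N v w i) :: real"
      let ?m = "\<Sum>i=1..N. \<integral>w. ?Z i w \<partial>noise \<mu> N"
      note [measurable] = max_step_measurable[of _ N]
      interpret H: Hoeffding_ineq "noise \<mu> N" "{1..N}" ?Z "\<lambda>_. 0" "\<lambda>_. 1" ?m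
      proof (unfold_locales)
        show "Q.indep_vars (\<lambda>_. borel) ?Z {1..N}"
          using indep_vars_max_step[OF N, of "\<lambda>i. i" "{1..N}"]
          by (rule Q.indep_vars_compose2) auto
      qed (simp_all split: split_indicator)
      let ?p = "1 - step_cdf \<mu> N v (Phi N v + x)"
      have m: "?m = real N * ?p"
      proof -
        have "(\<integral>w. ?Z i w \<partial>noise \<mu> N) = ?p" if "i \<in> {1..N}" for i
        proof -
          have "(\<integral>w. ?Z i w \<partial>noise \<mu> N)
            = (\<integral>w. indicator {w \<in> space (noise \<mu> N). max_step N v w i > Phi N v + x} w \<partial>noise \<mu> N)"
            by (intro Bochner_Integration.integral_cong) (auto simp: indicator_def)
          also have "\<dots> = measure (noise \<mu> N) {w \<in> space (noise \<mu> N). max_step N v w i > Phi N v + x}"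
            by (simp add: Int_absorb2 subset_eq)
          finally show ?thesis
            by (simp only: measure_max_step_greater[OF that])
        qed
        then show ?thesis by simp
      qed
      have "measure (noise \<mu> N) {w \<in> space (noise \<mu> N).
          \<bar>U_emp N (max_step N v w) (Phi N v + x) - (1 - exp (- exp (- x)))\<bar> > e}
        \<le> measure (noise \<mu> N) {w \<in> space (noise \<mu> N). \<bar>(\<Sum>i=1..N. ?Z i w) - ?m\<bar> \<ge> real N * (e / 2)}"
      proof (intro Q.finite_measure_mono subsetI CollectI conjI)
        fix w assume "w \<in> {w \<in> space (noise \<mu> N).
          \<bar>U_emp N (max_step N v w) (Phi N v + x) - (1 - exp (- exp (- x)))\<bar> > e}"
        then have "w \<in> space (noise \<mu> N)"
          and "\<bar>(\<Sum>i=1..N. ?Z i w) / real N - (1 - exp (- exp (- x)))\<bar> > e"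
          by (auto simp: U_emp_eq)
        moreover have "\<bar>step_cdf \<mu> N v (Phi N v + x) - exp (- exp (- x))\<bar> < e / 2"
          using \<eta>(2)[OF N] w by blast
        moreover have "\<bar>s - (1 - c)\<bar> \<ge> e / 2" if "\<bar>s - (1 - g)\<bar> > e" "\<bar>c - g\<bar> < e / 2" for s c g
          using that by linarith
        ultimately have "\<bar>(\<Sum>i=1..N. ?Z i w) / real N - ?p\<bar> \<ge> e / 2"
          by blast
        then have "real N * (e / 2) \<le> real N * \<bar>(\<Sum>i=1..N. ?Z i w) / real N - ?p\<bar>"
          by (intro mult_left_mono) auto
        also have "\<dots> = \<bar>real N * ((\<Sum>i=1..N. ?Z i w) / real N - ?p)\<bar>"
          by (simp add: abs_mult)
        also have "real N * ((\<Sum>i=1..N. ?Z i w) / real N - ?p) = (\<Sum>i=1..N. ?Z i w) - ?m"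
          unfolding m using N by (simp add: right_diff_distrib)
        finally show "\<bar>(\<Sum>i=1..N. ?Z i w) - ?m\<bar> \<ge> real N * (e / 2)" .
        show "w \<in> space (noise \<mu> N)" by fact
      qed measurable
      also have "\<dots> \<le> 2 * exp (- 2 * (real N * (e / 2))\<^sup>2 / (\<Sum>i=1..N. (1 - 0)\<^sup>2))"
        by (rule H.Hoeffding_ineq_abs_ge) (use assms N in auto)
      also have "- 2 * (real N * (e / 2))\<^sup>2 / (\<Sum>i=1..N. (1 - 0)\<^sup>2) = - (e\<^sup>2 / 2) * real N"
        using N by (simp add: power2_eq_square)
      finally show "measure (noise \<mu> N) {w \<in> space (noise \<mu> N).
         \<bar>U_emp N (max_step N v w) (Phi N v + x) - (1 - exp (- exp (- x)))\<bar> > e} \<le> e'"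
        using small by simp
    qed
  qed
qed

end

section \<open>Conditioning on the past\<close>

text \<open>Points of the product spaces are \<open>undefined\<close> outside the index set, whereas
  \<open>maxplus\<close> is defined on all indices. This and the following congruences pass between
  the two.\<close>

lemma max_step_cong:
  assumes "\<And>j. j \<in> {1..N} \<Longrightarrow> v j = v' j" "\<And>j. j \<in> {1..N} \<Longrightarrow> w (i, j) = w' (i, j)"
  shows "max_step N v w i = max_step N v' w' i"
  unfolding max_step_def using assms by (intro arg_cong[where f = Max] image_cong) auto

lemma Phi_cong: "(\<And>j. j \<in> {1..N} \<Longrightarrow> v j = v' j) \<Longrightarrow> Phi N v = Phi N v'"
  unfolding Phi_def by (intro arg_cong[where f = ln] sum.cong) auto

lemma weight_cong:
  "(\<And>j. j \<in> {1..N} \<Longrightarrow> v j = v' j) \<Longrightarrow> j \<in> {1..N} \<Longrightarrow> weight N v j = weight N v' j"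
  unfolding weight_def using Phi_cong[of N v v'] by simp

lemma U_emp_cong: "(\<And>j. j \<in> {1..N} \<Longrightarrow> v j = v' j) \<Longrightarrow> U_emp N v y = U_emp N v' y"
  unfolding U_emp_eq by (intro arg_cong2[where f = "(/)"] sum.cong) auto

lemma maxplus_Suc_eq_max_step:
  "maxplus N x0 xi (Suc t) i = max_step N (maxplus N x0 xi t) (\<lambda>p. xi (fst p) (snd p) (Suc t)) i"
  by (simp add: max_step_def)

lemma maxplus_cong:
  assumes "\<And>i j s. i \<in> {1..N} \<Longrightarrow> j \<in> {1..N} \<Longrightarrow> s \<in> {1..t} \<Longrightarrow> xi i j s = xi' i j s"
    and "i \<in> {1..N}"
  shows "maxplus N x0 xi t i = maxplus N x0 xi' t i"
  using assms
proof (induction t arbitrary: i)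
  case 0
  then show ?case by simp
next
  case (Suc t)
  show ?case
    unfolding maxplus_Suc_eq_max_step
    by (rule max_step_cong) (use Suc in auto)
qed

lemma max_step_measurable2:
  assumes "i \<in> {1..N}" "V \<in> measurable M (Pi\<^sub>M {1..N} (\<lambda>_. borel))"
    "W \<in> measurable M (Pi\<^sub>M ({1..N} \<times> {1..N}) (\<lambda>_. borel))"
  shows "(\<lambda>x. max_step N (V x) (W x) i) \<in> borel_measurable M"
  unfolding max_step_def using assms
  by (intro borel_measurable_Max borel_measurable_add
        measurable_compose[OF assms(2) measurable_component_singleton]
        measurable_compose[OF assms(3) measurable_component_singleton]) auto

lemma max_step_measurable_pair:
  "i \<in> {1..N} \<Longrightarrow> (\<lambda>p. max_step N (fst p) (snd p) i)
    \<in> borel_measurable (Pi\<^sub>M {1..N} (\<lambda>_. borel) \<Otimes>\<^sub>M Pi\<^sub>M ({1..N} \<times> {1..N}) (\<lambda>_. borel))"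
  by (intro max_step_measurable2 measurable_fst measurable_snd)

lemma Phi_measurable:
  assumes "\<And>j. j \<in> {1..N} \<Longrightarrow> (\<lambda>x. V x j) \<in> borel_measurable M"
  shows "(\<lambda>x. Phi N (V x)) \<in> borel_measurable M"
  unfolding Phi_def using assms
  by (intro borel_measurable_ln borel_measurable_sum borel_measurable_exp[THEN measurable_compose[rotated]])

lemma weight_measurable:
  assumes "\<And>j. j \<in> {1..N} \<Longrightarrow> (\<lambda>x. V x j) \<in> borel_measurable M" "j \<in> {1..N}"
  shows "(\<lambda>x. weight N (V x) j) \<in> borel_measurable M"
  unfolding weight_def using assms Phi_measurable[OF assms(1)]
  by (intro borel_measurable_diff borel_measurable_exp[THEN measurable_compose[rotated]]) auto

lemma U_emp_measurable:
  assumes "\<And>i. i \<in> {1..N} \<Longrightarrow> (\<lambda>x. V x i) \<in> borel_measurable M" "Y \<in> borel_measurable M"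
  shows "(\<lambda>x. U_emp N (V x) (Y x)) \<in> borel_measurable M"
proof -
  have "(\<lambda>x. indicator {Y x<..} (V x i) :: real) \<in> borel_measurable M" if "i \<in> {1..N}" for i
  proof -
    note [measurable] = assms(1)[OF that] assms(2)
    have "(\<lambda>x. indicator {Y x<..} (V x i) :: real) = (\<lambda>x. if Y x < V x i then 1 else 0)"
      by (simp add: fun_eq_iff indicator_def)
    then show ?thesis by simp
  qed
  then show ?thesis
    unfolding U_emp_eq by (intro borel_measurable_divide borel_measurable_sum) auto
qed

section \<open>The process for a fixed number of sites\<close>

locale last_passage = prob_space \<Omega> + \<mu>: real_distribution \<mu>
  for \<Omega> :: "'a measure" and \<mu> :: "real measure" +
  fixes N :: nat and x0 :: "nat \<Rightarrow> real" and X :: "nat \<Rightarrow> nat \<Rightarrow> nat \<Rightarrow> 'a \<Rightarrow> real"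
  assumes N_ge_1: "N \<ge> 1"
    and indep: "indep_vars (\<lambda>_. borel) (\<lambda>(i, j, s). X i j s) ({1..N} \<times> {1..N} \<times> {1..})"
    and X_law: "\<And>i j s. i \<in> {1..N} \<Longrightarrow> j \<in> {1..N} \<Longrightarrow> s \<ge> 1 \<Longrightarrow> distr \<Omega> borel (X i j s) = \<mu>"
begin

text \<open>Restricted to \<open>{1..N}\<close> so as to be a random element of the product space,
  on which its law is taken; likewise for \<open>passage\<close>.\<close>

definition front :: "nat \<Rightarrow> 'a \<Rightarrow> nat \<Rightarrow> real" where
  "front t \<omega> = (\<lambda>i\<in>{1..N}. maxplus N x0 (\<lambda>i j s. X i j s \<omega>) t i)"

definition passage :: "nat \<Rightarrow> 'a \<Rightarrow> nat \<times> nat \<Rightarrow> real" where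
  "passage t \<omega> = (\<lambda>p\<in>{1..N} \<times> {1..N}. X (fst p) (snd p) t \<omega>)"

lemma front_eq: "i \<in> {1..N} \<Longrightarrow> front t \<omega> i = maxplus N x0 (\<lambda>i j s. X i j s \<omega>) t i"
  by (simp add: front_def)

lemma front_Suc:
  assumes "i \<in> {1..N}"
  shows "front (Suc t) \<omega> i = max_step N (front t \<omega>) (passage (Suc t) \<omega>) i"
  unfolding front_eq[OF assms] maxplus_Suc_eq_max_step
  by (rule max_step_cong) (use assms in \<open>auto simp: front_def passage_def\<close>)

text \<open>The induction runs over \<open>s\<close> with the horizon \<open>t\<close> fixed, so
  that all stages live on the same product space.\<close>

lemma maxplus_measurable:
  assumes "s \<le> t" "i \<in> {1..N}"
  shows "(\<lambda>z. maxplus N x0 (\<lambda>i j s. z (i, j, s)) s i)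
    \<in> borel_measurable (Pi\<^sub>M ({1..N} \<times> {1..N} \<times> {1..t}) (\<lambda>_. borel))"
  using assms
proof (induction s arbitrary: i)
  case 0
  then show ?case by simp
next
  case (Suc s)
  have "(\<lambda>z. maxplus N x0 (\<lambda>i j s. z (i, j, s)) s j + z (i, j, Suc s))
      \<in> borel_measurable (Pi\<^sub>M ({1..N} \<times> {1..N} \<times> {1..t}) (\<lambda>_. borel))"
    if "j \<in> {1..N}" for j
    using Suc that by (intro borel_measurable_add measurable_component_singleton) auto
  then show ?case
    unfolding maxplus.simps by (intro borel_measurable_Max) auto
qed

text \<open>Restricting to singleton index sets turns independence over triples into independence
  over the pairs at the fixed time \<open>t\<close>.\<close>

lemma distr_passage:
  assumes "t \<ge> 1"
  shows "distr \<Omega> (Pi\<^sub>M ({1..N} \<times> {1..N}) (\<lambda>_. borel)) (passage t) = noise \<mu> N"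
proof -
  let ?I = "{1..N} \<times> {1..N}"
  let ?K = "\<lambda>p. {(fst p, snd p, t)}"
  have "indep_vars (\<lambda>p. Pi\<^sub>M (?K p) (\<lambda>_. borel))
      (\<lambda>p \<omega>. restrict (\<lambda>q. (\<lambda>(i, j, s). X i j s) q \<omega>) (?K p)) ?I"
    by (rule indep_vars_restrict[OF indep]) (use assms in \<open>auto simp: disjoint_family_on_def\<close>)
  then have "indep_vars (\<lambda>_. borel)
      (\<lambda>p \<omega>. (\<lambda>z. z (fst p, snd p, t)) (restrict (\<lambda>q. (\<lambda>(i, j, s). X i j s) q \<omega>) (?K p))) ?I"
    by (rule indep_vars_compose2) (rule measurable_component_singleton, simp)
  then have ind: "indep_vars (\<lambda>_. borel) (\<lambda>p. X (fst p) (snd p) t) ?I"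
    by simp
  then have "distr \<Omega> (Pi\<^sub>M ?I (\<lambda>_. borel)) (\<lambda>\<omega>. \<lambda>p\<in>?I. X (fst p) (snd p) t \<omega>)
      = Pi\<^sub>M ?I (\<lambda>p. distr \<Omega> borel (X (fst p) (snd p) t))"
    using N_ge_1 by (subst indep_vars_iff_distr_eq_PiM'[symmetric]) (auto simp: indep_vars_def)
  also have "\<dots> = noise \<mu> N"
    unfolding noise_def by (rule PiM_cong) (use assms in \<open>auto intro: X_law\<close>)
  also have "(\<lambda>\<omega>. \<lambda>p\<in>?I. X (fst p) (snd p) t \<omega>) = passage t"
    by (simp add: fun_eq_iff passage_def)
  finally show ?thesis .
qed

text \<open>The front at time \<open>t\<close> is a function of the passage times up to
  \<open>t\<close>, the next step uses those at \<open>Suc t\<close>. These blocks are disjoint,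
  hence independent, and their product law is pushed forward by the pair of functions.\<close>

lemma front_measurable: "front t \<in> measurable \<Omega> (Pi\<^sub>M {1..N} (\<lambda>_. borel))"
  and passage_measurable: "passage (Suc t) \<in> measurable \<Omega> (Pi\<^sub>M ({1..N} \<times> {1..N}) (\<lambda>_. borel))"
  and distr_front_passage:
    "distr \<Omega> (Pi\<^sub>M {1..N} (\<lambda>_. borel) \<Otimes>\<^sub>M Pi\<^sub>M ({1..N} \<times> {1..N}) (\<lambda>_. borel))
       (\<lambda>\<omega>. (front t \<omega>, passage (Suc t) \<omega>))
     = distr \<Omega> (Pi\<^sub>M {1..N} (\<lambda>_. borel)) (front t) \<Otimes>\<^sub>M noise \<mu> N"
proof -
  \<comment> \<open>For \<open>t = 0\<close> the first block is empty and the front is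
    deterministic.\<close>
  let ?A = "{1..N} \<times> {1..N} \<times> {1..t}" and ?B = "{1..N} \<times> {1..N} \<times> {Suc t}"
  let ?Z = "\<lambda>D \<omega>. restrict (\<lambda>p. (\<lambda>(i, j, s). X i j s) p \<omega>) D"
  let ?f = "\<lambda>z. \<lambda>i\<in>{1..N}. maxplus N x0 (\<lambda>i j s. z (i, j, s)) t i"
  let ?g = "\<lambda>z. \<lambda>p\<in>{1..N} \<times> {1..N}. z (fst p, snd p, Suc t)"
  let ?MA = "Pi\<^sub>M ?A (\<lambda>_. borel) :: (nat \<times> nat \<times> nat \<Rightarrow> real) measure"
  let ?MB = "Pi\<^sub>M ?B (\<lambda>_. borel) :: (nat \<times> nat \<times> nat \<Rightarrow> real) measure"
  let ?V = "Pi\<^sub>M {1..N} (\<lambda>_. borel) :: (nat \<Rightarrow> real) measure"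
  let ?W = "Pi\<^sub>M ({1..N} \<times> {1..N}) (\<lambda>_. borel) :: (nat \<times> nat \<Rightarrow> real) measure"
  have "indep_var ?MA (?Z ?A) ?MB (?Z ?B)"
    by (rule indep_var_restrict[OF indep]) auto
  then have Z [measurable]: "?Z ?A \<in> measurable \<Omega> ?MA" "?Z ?B \<in> measurable \<Omega> ?MB"
    and joint: "distr \<Omega> ?MA (?Z ?A) \<Otimes>\<^sub>M distr \<Omega> ?MB (?Z ?B)
      = distr \<Omega> (?MA \<Otimes>\<^sub>M ?MB) (\<lambda>\<omega>. (?Z ?A \<omega>, ?Z ?B \<omega>))"
    by (simp_all only: indep_var_distribution_eq)
  have f [measurable]: "?f \<in> measurable ?MA ?V"
    by (intro measurable_restrict maxplus_measurable) auto
  have g [measurable]: "?g \<in> measurable ?MB ?W"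
    by (intro measurable_restrict measurable_component_singleton) auto
  have front: "front t = (\<lambda>\<omega>. ?f (?Z ?A \<omega>))"
    by (auto simp: fun_eq_iff front_def intro!: maxplus_cong)
  have passage: "passage (Suc t) = (\<lambda>\<omega>. ?g (?Z ?B \<omega>))"
    by (auto simp: fun_eq_iff passage_def)
  show front_m: "front t \<in> measurable \<Omega> ?V"
    unfolding front by (rule measurable_compose[OF Z(1) f])
  show passage_m: "passage (Suc t) \<in> measurable \<Omega> ?W"
    unfolding passage by (rule measurable_compose[OF Z(2) g])
  have fg: "(\<lambda>(x, y). (?f x, ?g y)) \<in> measurable (?MA \<Otimes>\<^sub>M ?MB) (?V \<Otimes>\<^sub>M ?W)"
    unfolding split_beta'
    by (intro measurable_Pair measurable_compose[OF measurable_fst f] measurable_compose[OF measurable_snd g])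
  have "distr \<Omega> ?V (front t) = distr (distr \<Omega> ?MA (?Z ?A)) ?V ?f"
    unfolding front distr_distr[OF f Z(1)] comp_def ..
  moreover have "noise \<mu> N = distr (distr \<Omega> ?MB (?Z ?B)) ?W ?g"
    \<comment> \<open>The instance of \<open>le_add1\<close> is the side condition
      \<open>1 \<le> Suc t\<close>.\<close>
    unfolding distr_passage[of "Suc t", symmetric, OF le_add1[of 1 t, unfolded plus_1_eq_Suc]]
      passage distr_distr[OF g Z(2)] comp_def ..
  ultimately have "distr \<Omega> ?V (front t) \<Otimes>\<^sub>M noise \<mu> N
      = distr (distr \<Omega> ?MA (?Z ?A)) ?V ?f \<Otimes>\<^sub>M distr (distr \<Omega> ?MB (?Z ?B)) ?W ?g"
    by simp
  also have "\<dots> = distr (distr \<Omega> ?MA (?Z ?A) \<Otimes>\<^sub>M distr \<Omega> ?MB (?Z ?B)) (?V \<Otimes>\<^sub>M ?W) (\<lambda>(x, y). (?f x, ?g y))"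
  proof (rule pair_measure_distr)
    have "prob_space (distr (distr \<Omega> ?MB (?Z ?B)) ?W ?g)"
      by (rule prob_space.prob_space_distr[OF prob_space_distr[OF Z(2)]])
         (simp only: measurable_distr_eq1 g)
    then show "sigma_finite_measure (distr (distr \<Omega> ?MB (?Z ?B)) ?W ?g)"
      by (rule prob_space_imp_sigma_finite)
  qed (simp_all only: measurable_distr_eq1 f g)
  also have "\<dots> = distr \<Omega> (?V \<Otimes>\<^sub>M ?W) (\<lambda>\<omega>. (front t \<omega>, passage (Suc t) \<omega>))"
    unfolding joint front passage distr_distr[OF fg measurable_Pair[OF Z]] by (simp only: comp_def split)
  finally show "distr \<Omega> (?V \<Otimes>\<^sub>M ?W) (\<lambda>\<omega>. (front t \<omega>, passage (Suc t) \<omega>))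
      = distr \<Omega> ?V (front t) \<Otimes>\<^sub>M noise \<mu> N" ..
qed

text \<open>Conditioning on the past: as the passage times of the next step are independent of the
  current front, it is enough to estimate the step from each fixed front in \<open>B\<close>.\<close>

lemma expectation_step_le:
  fixes h :: "(nat \<Rightarrow> real) \<times> (nat \<times> nat \<Rightarrow> real) \<Rightarrow> real"
  assumes h: "h \<in> borel_measurable (Pi\<^sub>M {1..N} (\<lambda>_. borel) \<Otimes>\<^sub>M Pi\<^sub>M ({1..N} \<times> {1..N}) (\<lambda>_. borel))"
    and bound: "\<And>p. \<bar>h p\<bar> \<le> C"
    and B: "B \<in> sets (Pi\<^sub>M {1..N} (\<lambda>_. borel))"
    and good: "\<And>v. v \<in> B \<Longrightarrow> \<bar>\<integral>w. h (v, w) \<partial>noise \<mu> N\<bar> \<le> e" and "e \<ge> 0"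
  shows "\<bar>\<integral>\<omega>. h (front t \<omega>, passage (Suc t) \<omega>) \<partial>\<Omega>\<bar>
    \<le> e + C * prob {\<omega> \<in> space \<Omega>. front t \<omega> \<notin> B}"
proof -
  let ?V = "Pi\<^sub>M {1..N} (\<lambda>_. borel) :: (nat \<Rightarrow> real) measure"
  let ?W = "Pi\<^sub>M ({1..N} \<times> {1..N}) (\<lambda>_. borel) :: (nat \<times> nat \<Rightarrow> real) measure"
  let ?P = "distr \<Omega> ?V (front t)"
  note [measurable] = front_measurable[of t] passage_measurable[of t] h B
  interpret P: prob_space ?P by (rule prob_space_distr) measurable
  interpret Q: prob_space "noise \<mu> N" by (rule \<mu>.prob_space_noise)
  interpret PQ: pair_prob_space ?P "noise \<mu> N" ..
  have C: "C \<ge> 0" using bound[of undefined] by linarith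
  have joint: "distr \<Omega> (?V \<Otimes>\<^sub>M ?W) (\<lambda>\<omega>. (front t \<omega>, passage (Suc t) \<omega>)) = ?P \<Otimes>\<^sub>M noise \<mu> N"
    by (rule distr_front_passage)
  have sets: "sets (?P \<Otimes>\<^sub>M noise \<mu> N) = sets (?V \<Otimes>\<^sub>M ?W)"
    by (intro sets_pair_measure_cong) (simp_all add: \<mu>.sets_noise)
  have hPQ [measurable]: "h \<in> borel_measurable (?P \<Otimes>\<^sub>M noise \<mu> N)"
    using h unfolding measurable_cong_sets[OF sets refl] .
  have int: "integrable (?P \<Otimes>\<^sub>M noise \<mu> N) h"
    by (rule PQ.integrable_const_bound[OF _ hPQ, of C]) (simp add: bound)
  have "(\<integral>\<omega>. h (front t \<omega>, passage (Suc t) \<omega>) \<partial>\<Omega>) = (\<integral>p. h p \<partial>(?P \<Otimes>\<^sub>M noise \<mu> N))"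
    unfolding joint[symmetric]
    by (rule integral_distr[symmetric, OF measurable_Pair[OF front_measurable passage_measurable] h])
  also have "\<dots> = (\<integral>v. (\<integral>w. h (v, w) \<partial>noise \<mu> N) \<partial>?P)"
    using PQ.integral_fst'[OF int] by simp
  finally have eq: "(\<integral>\<omega>. h (front t \<omega>, passage (Suc t) \<omega>) \<partial>\<Omega>)
    = (\<integral>v. (\<integral>w. h (v, w) \<partial>noise \<mu> N) \<partial>?P)" .
  let ?B' = "space ?V - B"
  have intB: "integrable ?P (indicator ?B' :: _ \<Rightarrow> real)"
    by (intro integrable_real_indicator) (use B P.emeasure_finite in \<open>auto simp: less_top\<close>)
  have "\<bar>\<integral>v. (\<integral>w. h (v, w) \<partial>noise \<mu> N) \<partial>?P\<bar> \<le> (\<integral>v. \<bar>\<integral>w. h (v, w) \<partial>noise \<mu> N\<bar> \<partial>?P)"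
    by (rule integral_abs_bound)
  \<comment> \<open>A front in \<open>B\<close> contributes at most \<open>e\<close>, any other at
    most the trivial bound \<open>C\<close>.\<close>
  also have "\<dots> \<le> (\<integral>v. e + C * indicator ?B' v \<partial>?P)"
  proof (rule integral_mono)
    show "integrable ?P (\<lambda>v. \<bar>\<integral>w. h (v, w) \<partial>noise \<mu> N\<bar>)"
      using PQ.integrable_fst'[OF int] by (rule integrable_abs)
    show "integrable ?P (\<lambda>v. e + C * indicator ?B' v)"
      by (intro Bochner_Integration.integrable_add P.integrable_const integrable_mult_right intB)
    fix v assume v: "v \<in> space ?P"
    have "\<bar>\<integral>w. h (v, w) \<partial>noise \<mu> N\<bar> \<le> (\<integral>w. \<bar>h (v, w)\<bar> \<partial>noise \<mu> N)"
      by (rule integral_abs_bound)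
    also have "\<dots> \<le> C"
    proof (rule Q.integral_le_const)
      show "integrable (noise \<mu> N) (\<lambda>w. \<bar>h (v, w)\<bar>)"
        by (rule Q.integrable_const_bound[of _ C])
           (use v in \<open>auto simp: bound intro!: borel_measurable_abs measurable_compose[OF measurable_Pair1' hPQ]\<close>)
    qed (simp add: bound)
    finally have "\<bar>\<integral>w. h (v, w) \<partial>noise \<mu> N\<bar> \<le> C" .
    then show "\<bar>\<integral>w. h (v, w) \<partial>noise \<mu> N\<bar> \<le> e + C * indicator ?B' v"
      using v good[of v] C \<open>e \<ge> 0\<close> by (cases "v \<in> B") auto
  qed
  also have "\<dots> = e + C * measure ?P ?B'"
  proof -
    have "(\<integral>v. e + C * indicator ?B' v \<partial>?P) = (\<integral>v. e \<partial>?P) + (\<integral>v. C * indicator ?B' v \<partial>?P)"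
      by (intro Bochner_Integration.integral_add P.integrable_const integrable_mult_right intB)
    then show ?thesis
      using P.prob_space by (simp add: Int_absorb2)
  qed
  also have "measure ?P ?B' = prob {\<omega> \<in> space \<Omega>. front t \<omega> \<notin> B}"
    using measurable_space[OF front_measurable[of t]]
    by (subst measure_distr[OF front_measurable sets.Diff[OF sets.top B]])
       (auto intro!: arg_cong[where f = prob])
  finally show ?thesis
    unfolding eq .
qed

text \<open>The preceding estimate for an indicator, with \<open>C = 1\<close>.\<close>

lemma prob_step_le:
  assumes A: "{p \<in> space (Pi\<^sub>M {1..N} (\<lambda>_. borel) \<Otimes>\<^sub>M Pi\<^sub>M ({1..N} \<times> {1..N}) (\<lambda>_. borel)). R (fst p) (snd p)}
      \<in> sets (Pi\<^sub>M {1..N} (\<lambda>_. borel) \<Otimes>\<^sub>M Pi\<^sub>M ({1..N} \<times> {1..N}) (\<lambda>_. borel))"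
    and B: "B \<in> sets (Pi\<^sub>M {1..N} (\<lambda>_. borel))"
    and good: "\<And>v. v \<in> B \<Longrightarrow> measure (noise \<mu> N) {w \<in> space (noise \<mu> N). R v w} \<le> e" and e: "e \<ge> 0"
  shows "prob {\<omega> \<in> space \<Omega>. R (front t \<omega>) (passage (Suc t) \<omega>)}
    \<le> e + prob {\<omega> \<in> space \<Omega>. front t \<omega> \<notin> B}"
proof -
  let ?VW = "Pi\<^sub>M {1..N} (\<lambda>_. borel) \<Otimes>\<^sub>M Pi\<^sub>M ({1..N} \<times> {1..N}) (\<lambda>_. borel)
    :: ((nat \<Rightarrow> real) \<times> (nat \<times> nat \<Rightarrow> real)) measure"
  let ?A = "{p \<in> space ?VW. R (fst p) (snd p)}"
  have sp: "space (noise \<mu> N) = space (Pi\<^sub>M ({1..N} \<times> {1..N}) (\<lambda>_. borel))"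
    by (intro sets_eq_imp_space_eq \<mu>.sets_noise)
  have "\<bar>\<integral>\<omega>. indicator ?A (front t \<omega>, passage (Suc t) \<omega>) \<partial>\<Omega>\<bar>
    \<le> e + 1 * prob {\<omega> \<in> space \<Omega>. front t \<omega> \<notin> B}"
  proof (rule expectation_step_le[OF _ _ B _ e])
    show "indicator ?A \<in> borel_measurable ?VW"
      using A by (rule borel_measurable_indicator)
    show "\<bar>indicator ?A p :: real\<bar> \<le> 1" for p
      by (simp add: indicator_def)
    fix v assume v: "v \<in> B"
    then have "v \<in> space (Pi\<^sub>M {1..N} (\<lambda>_. borel))"
      using sets.sets_into_space[OF B] by auto
    then have "(\<integral>w. indicator ?A (v, w) \<partial>noise \<mu> N)
        = (\<integral>w. indicator {w \<in> space (noise \<mu> N). R v w} w \<partial>noise \<mu> N :: real)"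
      by (intro Bochner_Integration.integral_cong) (auto simp: indicator_def space_pair_measure sp)
    also have "\<dots> = measure (noise \<mu> N) {w \<in> space (noise \<mu> N). R v w}"
      by (simp add: Int_absorb2 subset_eq)
    finally show "\<bar>\<integral>w. indicator ?A (v, w) \<partial>noise \<mu> N\<bar> \<le> e"
      using good[OF v] by simp
  qed
  also have "(\<integral>\<omega>. indicator ?A (front t \<omega>, passage (Suc t) \<omega>) \<partial>\<Omega>)
      = (\<integral>\<omega>. indicator {\<omega> \<in> space \<Omega>. R (front t \<omega>) (passage (Suc t) \<omega>)} \<omega> \<partial>\<Omega> :: real)"
    using measurable_space[OF front_measurable[of t]] measurable_space[OF passage_measurable[of t]]
    by (intro Bochner_Integration.integral_cong) (auto simp: indicator_def space_pair_measure)
  also have "\<dots> = prob {\<omega> \<in> space \<Omega>. R (front t \<omega>) (passage (Suc t) \<omega>)}"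
    by (simp add: Int_absorb2 subset_eq)
  finally show ?thesis
    by simp
qed

end

section \<open>Uniformity and the limit theorem\<close>

text \<open>Polya's argument: a monotone function that is close to a continuous tail at finitely
  many quantiles is close to it everywhere. \<open>G\<close> depends on \<open>e\<close> alone, so
  it is fixed before the random \<open>U\<close> is seen.\<close>

lemma antimono_near_gumbel_tail:
  fixes e :: real
  assumes "e > 0"
  obtains G :: "real set" where "finite G"
    "\<And>U x. antimono U \<Longrightarrow> (\<And>y. 0 \<le> U y \<and> U y \<le> 1) \<Longrightarrow>
       (\<And>g. g \<in> G \<Longrightarrow> \<bar>U g - (1 - exp (- exp (- g)))\<bar> \<le> e / 2) \<Longrightarrow>
       \<bar>U x - (1 - exp (- exp (- x)))\<bar> \<le> e"
proof -
  let ?F = "\<lambda>x::real. exp (- exp (- x))"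
  \<comment> \<open>Cells of Gumbel mass \<open>1 / m\<close> below \<open>e / 2\<close> leave the
    other half of \<open>e\<close> for the error at the grid points.\<close>
  obtain m :: nat where m: "real m > 2 / e"
    using reals_Archimedean2 by blast
  then have m_pos: "real m > 0"
    using assms by (smt (verit) divide_pos_pos)
  then have m_inv: "1 / real m < e / 2"
    using m assms by (simp add: field_simps)
  \<comment> \<open>The Gumbel quantile of level \<open>k / m\<close>.\<close>
  define q where "q k = - ln (- ln (real k / real m))" for k
  have F_q: "?F (q k) = real k / real m" if "0 < k" "k < m" for k
    using that m_pos by (simp add: q_def ln_less_zero_iff)
  have F_less: "?F x < ?F y \<Longrightarrow> x < y" and F_le: "?F x \<le> ?F y \<Longrightarrow> x \<le> y" for x y
    by simp_all
  show thesis
  proof (rule that[of "q ` {1..<m}"])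
    fix U :: "real \<Rightarrow> real" and x
    assume U: "antimono U" "\<And>y. 0 \<le> U y \<and> U y \<le> 1"
      and grid: "\<And>g. g \<in> q ` {1..<m} \<Longrightarrow> \<bar>U g - (1 - ?F g)\<bar> \<le> e / 2"
    \<comment> \<open>\<open>x\<close> lies between \<open>q k\<close> and \<open>q (k + 1)\<close>.
      For \<open>k = 0\<close> or \<open>k + 1 = m\<close> one of these quantiles would be infinite,
      and the bounds 0 and 1 on \<open>U\<close> take its place.\<close>
    define k where "k = nat \<lfloor>?F x * real m\<rfloor>"
    have "0 \<le> ?F x * real m" by simp
    then have k: "real k \<le> ?F x * real m" "?F x * real m < real k + 1"
      unfolding k_def by linarith+
    then have k': "real k / real m \<le> ?F x" "?F x < (real k + 1) / real m"
      using m_pos by (simp_all add: field_simps)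
    have "?F x * real m < 1 * real m"
      using m_pos by (intro mult_strict_right_mono) simp_all
    then have "k < m"
      using k(1) by simp
    have grid_q: "\<bar>U (q j) - (1 - real j / real m)\<bar> \<le> e / 2" if "0 < j" "j < m" for j
      using grid[of "q j"] F_q[OF that] that by simp
    have step: "(real k + 1) / real m = real k / real m + 1 / real m"
      by (simp add: add_divide_distrib)
    have "U x \<le> 1 - real k / real m + e / 2"
    proof (cases "k = 0")
      case True
      then show ?thesis using U(2)[of x] assms by simp
    next
      case False
      then have "q k \<le> x"
        using F_q[of k] k'(1) \<open>k < m\<close> F_le[of "q k" x] by simp
      then have "U x \<le> U (q k)"
        using U(1) by (simp add: antimonoD)
      then show ?thesis
        using grid_q[OF _ \<open>k < m\<close>] False by linarith
    qed
    moreover have "1 - (real k + 1) / real m - e / 2 \<le> U x"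
    proof (cases "k + 1 = m")
      case True
      then have "(real k + 1) / real m = 1"
        using m_pos by (simp flip: True)
      then show ?thesis using U(2)[of x] assms by simp
    next
      case False
      then have "k + 1 < m" using \<open>k < m\<close> by simp
      then have "x \<le> q (k + 1)"
        using F_q[of "k + 1"] k'(2) F_less[of x "q (k + 1)"] by (simp add: add.commute)
      then have "U (q (k + 1)) \<le> U x"
        using U(1) by (simp add: antimonoD)
      moreover have "\<bar>U (q (k + 1)) - (1 - (real k + 1) / real m)\<bar> \<le> e / 2"
        using grid_q[OF _ \<open>k + 1 < m\<close>] by (simp add: add.commute)
      ultimately show ?thesis
        by linarith
    qed
    ultimately show "\<bar>U x - (1 - ?F x)\<bar> \<le> e"
      using k' m_inv step by linarith
  qed simp
qed

lemma U_emp_antimono: "antimono (\<lambda>x. U_emp N u (c + x))"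
  unfolding U_emp_def
  by (intro antimonoI divide_right_mono of_nat_mono card_mono) auto

lemma U_emp_bounds: "0 \<le> U_emp N u y" "U_emp N u y \<le> 1"
proof -
  have "card {i\<in>{1..N}. u i > y} \<le> card {1..N}"
    by (rule card_mono) auto
  then show "U_emp N u y \<le> 1"
    by (cases "N = 0") (simp_all add: U_emp_def divide_le_eq_1)
qed (simp add: U_emp_def)

section \<open>One-step estimates transferred to the process\<close>

context last_passage
begin

lemma weights_le_sets:
  "{v \<in> space (Pi\<^sub>M {1..N} (\<lambda>_. borel)). \<forall>j\<in>{1..N}. weight N v j \<le> \<eta>} \<in> sets (Pi\<^sub>M {1..N} (\<lambda>_. borel))"
proof -
  have "(\<lambda>v. weight N v j) \<in> borel_measurable (Pi\<^sub>M {1..N} (\<lambda>_. borel))" if "j \<in> {1..N}" for j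
    by (rule weight_measurable) (use that in \<open>auto intro: measurable_component_singleton\<close>)
  then show ?thesis
    by (intro sets.sets_Collect_finite_All borel_measurable_le) auto
qed

text \<open>The one-step bound holds from every front, so the good set at time \<open>t\<close> is
  the whole space and its complement costs nothing.\<close>

lemma prob_weights_front_Suc:
  assumes "\<And>v. measure (noise \<mu> N) {w \<in> space (noise \<mu> N). \<exists>j\<in>{1..N}. weight N (max_step N v w) j > \<eta>} \<le> e"
    and "e \<ge> 0"
  shows "prob {\<omega> \<in> space \<Omega>. front (Suc t) \<omega>
      \<notin> {v \<in> space (Pi\<^sub>M {1..N} (\<lambda>_. borel)). \<forall>j\<in>{1..N}. weight N v j \<le> \<eta>}} \<le> e"
proof -
  let ?V = "Pi\<^sub>M {1..N} (\<lambda>_. borel) :: (nat \<Rightarrow> real) measure"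
  let ?W = "Pi\<^sub>M ({1..N} \<times> {1..N}) (\<lambda>_. borel) :: (nat \<times> nat \<Rightarrow> real) measure"
  let ?R = "\<lambda>v w. \<exists>j\<in>{1..N}. weight N (max_step N v w) j > \<eta>"
  have "(\<lambda>p. weight N (max_step N (fst p) (snd p)) j) \<in> borel_measurable (?V \<Otimes>\<^sub>M ?W)"
    if "j \<in> {1..N}" for j
    using that by (intro weight_measurable max_step_measurable_pair)
  then have "{p \<in> space (?V \<Otimes>\<^sub>M ?W). ?R (fst p) (snd p)} \<in> sets (?V \<Otimes>\<^sub>M ?W)"
    by (intro sets.sets_Collect_finite_Ex borel_measurable_less) auto
  from prob_step_le[OF this sets.top, of e t] assms
  have "prob {\<omega> \<in> space \<Omega>. ?R (front t \<omega>) (passage (Suc t) \<omega>)}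
    \<le> e + prob {\<omega> \<in> space \<Omega>. front t \<omega> \<notin> space ?V}"
    by blast
  also have "{\<omega> \<in> space \<Omega>. front t \<omega> \<notin> space ?V} = {}"
    using measurable_space[OF front_measurable[of t]] by blast
  also have "{\<omega> \<in> space \<Omega>. ?R (front t \<omega>) (passage (Suc t) \<omega>)}
      = {\<omega> \<in> space \<Omega>. front (Suc t) \<omega> \<notin> {v \<in> space ?V. \<forall>j\<in>{1..N}. weight N v j \<le> \<eta>}}"
  proof -
    have "weight N (max_step N (front t \<omega>) (passage (Suc t) \<omega>)) j = weight N (front (Suc t) \<omega>) j"
      if "j \<in> {1..N}" for j \<omega>
      using that by (intro weight_cong) (simp_all add: front_Suc)
    then show ?thesis
      using measurable_space[OF front_measurable[of "Suc t"]] by (auto simp: not_le)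
  qed
  finally show ?thesis by simp
qed

text \<open>Subtracting \<open>c\<close> before conditioning turns closeness to \<open>c\<close> on
  good fronts into the smallness that \<open>expectation_step_le\<close> asks for.\<close>

lemma expectation_front_step:
  fixes f :: "('k::finite \<Rightarrow> real) \<Rightarrow> real"
  assumes f: "continuous_on UNIV f" "\<And>y. \<bar>f y - c\<bar> \<le> C"
    and \<kappa>: "range \<kappa> \<subseteq> {1..N}" and B: "B \<in> sets (Pi\<^sub>M {1..N} (\<lambda>_. borel))"
    and good: "\<And>v. v \<in> B \<Longrightarrow>
      \<bar>(\<integral>w. f (\<lambda>a. max_step N v w (\<kappa> a) - Phi N v) \<partial>noise \<mu> N) - c\<bar> \<le> e" and e: "e \<ge> 0"
  shows "\<bar>(\<integral>\<omega>. f (\<lambda>a. front (Suc t) \<omega> (\<kappa> a) - Phi N (front t \<omega>)) \<partial>\<Omega>) - c\<bar>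
    \<le> e + C * prob {\<omega> \<in> space \<Omega>. front t \<omega> \<notin> B}"
proof -
  let ?V = "Pi\<^sub>M {1..N} (\<lambda>_. borel) :: (nat \<Rightarrow> real) measure"
  let ?W = "Pi\<^sub>M ({1..N} \<times> {1..N}) (\<lambda>_. borel) :: (nat \<times> nat \<Rightarrow> real) measure"
  let ?g = "\<lambda>p. f (\<lambda>a. max_step N (fst p) (snd p) (\<kappa> a) - Phi N (fst p))"
  interpret Q: prob_space "noise \<mu> N" by (rule \<mu>.prob_space_noise)
  have \<kappa>_in: "\<kappa> a \<in> {1..N}" for a using \<kappa> by blast
  have f_le: "\<bar>f y\<bar> \<le> C + \<bar>c\<bar>" for y
    using f(2)[of y] by linarith
  have "(\<lambda>p a. max_step N (fst p) (snd p) (\<kappa> a) - Phi N (fst p))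
      \<in> measurable (?V \<Otimes>\<^sub>M ?W) (Pi\<^sub>M UNIV (\<lambda>_. borel))"
    by (intro measurable_PiM_single' borel_measurable_diff max_step_measurable_pair[OF \<kappa>_in] Phi_measurable
          measurable_compose[OF measurable_fst measurable_component_singleton]) auto
  then have g: "?g \<in> borel_measurable (?V \<Otimes>\<^sub>M ?W)"
    by (rule measurable_compose[OF _ borel_measurable_continuous_PiM[OF f(1)]])
  have "\<bar>\<integral>\<omega>. ?g (front t \<omega>, passage (Suc t) \<omega>) - c \<partial>\<Omega>\<bar>
    \<le> e + C * prob {\<omega> \<in> space \<Omega>. front t \<omega> \<notin> B}"
  proof (rule expectation_step_le[OF _ _ B _ e])
    show "(\<lambda>p. ?g p - c) \<in> borel_measurable (?V \<Otimes>\<^sub>M ?W)"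
      using g by simp
    show "\<bar>?g p - c\<bar> \<le> C" for p by (rule f(2))
    fix v assume v: "v \<in> B"
    have "v \<in> space ?V"
      using v sets.sets_into_space[OF B] by auto
    from measurable_compose[OF measurable_Pair1'[OF this] g]
    have "(\<lambda>w. ?g (v, w)) \<in> borel_measurable (noise \<mu> N)"
      by (subst measurable_cong_sets[OF \<mu>.sets_noise refl])
    then have "integrable (noise \<mu> N) (\<lambda>w. ?g (v, w))"
      by (intro Q.integrable_const_bound[of _ "C + \<bar>c\<bar>"]) (auto simp: f_le)
    then have "(\<integral>w. ?g (v, w) - c \<partial>noise \<mu> N) = (\<integral>w. ?g (v, w) \<partial>noise \<mu> N) - c"
      by (simp add: Q.prob_space)
    then show "\<bar>\<integral>w. ?g (v, w) - c \<partial>noise \<mu> N\<bar> \<le> e"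
      using good[OF v] by simp
  qed
  moreover have "(\<integral>\<omega>. ?g (front t \<omega>, passage (Suc t) \<omega>) - c \<partial>\<Omega>)
      = (\<integral>\<omega>. ?g (front t \<omega>, passage (Suc t) \<omega>) \<partial>\<Omega>) - c"
  proof -
    have "integrable \<Omega> (\<lambda>\<omega>. ?g (front t \<omega>, passage (Suc t) \<omega>))"
      by (rule integrable_const_bound[of _ "C + \<bar>c\<bar>", OF AE_I2])
         (simp only: f_le real_norm_def,
          rule measurable_compose[OF measurable_Pair[OF front_measurable passage_measurable] g])
    then show ?thesis
      by (simp add: prob_space)
  qed
  ultimately show ?thesis
    by (simp add: front_Suc[OF \<kappa>_in])
qed

lemma U_emp_front_measurable: "(\<lambda>\<omega>. U_emp N (front s \<omega>) (Phi N (front t \<omega>) + x)) \<in> borel_measurable \<Omega>"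
  by (intro U_emp_measurable borel_measurable_add Phi_measurable borel_measurable_const
        measurable_compose[OF front_measurable measurable_component_singleton]) auto

lemma prob_U_emp_front_step:
  assumes B: "B \<in> sets (Pi\<^sub>M {1..N} (\<lambda>_. borel))"
    and good: "\<And>v. v \<in> B \<Longrightarrow> measure (noise \<mu> N) {w \<in> space (noise \<mu> N).
      \<bar>U_emp N (max_step N v w) (Phi N v + x) - c\<bar> > r} \<le> e" and e: "e \<ge> 0"
  shows "prob {\<omega> \<in> space \<Omega>. \<bar>U_emp N (front (Suc t) \<omega>) (Phi N (front t \<omega>) + x) - c\<bar> > r}
    \<le> e + prob {\<omega> \<in> space \<Omega>. front t \<omega> \<notin> B}"
proof -
  let ?V = "Pi\<^sub>M {1..N} (\<lambda>_. borel) :: (nat \<Rightarrow> real) measure"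
  let ?W = "Pi\<^sub>M ({1..N} \<times> {1..N}) (\<lambda>_. borel) :: (nat \<times> nat \<Rightarrow> real) measure"
  let ?R = "\<lambda>v w. \<bar>U_emp N (max_step N v w) (Phi N v + x) - c\<bar> > r"
  have "(\<lambda>p. U_emp N (max_step N (fst p) (snd p)) (Phi N (fst p) + x)) \<in> borel_measurable (?V \<Otimes>\<^sub>M ?W)"
    by (intro U_emp_measurable borel_measurable_add borel_measurable_const Phi_measurable max_step_measurable_pair
          measurable_compose[OF measurable_fst measurable_component_singleton])
  then have "{p \<in> space (?V \<Otimes>\<^sub>M ?W). ?R (fst p) (snd p)} \<in> sets (?V \<Otimes>\<^sub>M ?W)"
    by (intro borel_measurable_less borel_measurable_abs borel_measurable_diff) auto
  from prob_step_le[OF this B good e]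
  have "prob {\<omega> \<in> space \<Omega>. ?R (front t \<omega>) (passage (Suc t) \<omega>)}
    \<le> e + prob {\<omega> \<in> space \<Omega>. front t \<omega> \<notin> B}" .
  moreover have "U_emp N (max_step N (front t \<omega>) (passage (Suc t) \<omega>)) y = U_emp N (front (Suc t) \<omega>) y" for \<omega> y
    by (intro U_emp_cong) (simp add: front_Suc)
  ultimately show ?thesis by simp
qed

lemma maxplus_eq_front:
  shows "Phi N (maxplus N x0 (\<lambda>i j s. X i j s \<omega>) t) = Phi N (front t \<omega>)"
    and "U_emp N (maxplus N x0 (\<lambda>i j s. X i j s \<omega>) t) y = U_emp N (front t \<omega>) y"
  by (intro Phi_cong U_emp_cong; simp add: front_eq)+

end

text \<open>The set of observed sites enters as the range of an injection from a type with
  \<open>k\<close> elements, so that for all \<open>N\<close> the laws live on one space. Such an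
  injection exists only once \<open>N\<close> is at least \<open>k\<close>.\<close>

theorem theorem1p2:
  fixes \<mu> :: "real measure"
    and \<delta> :: real
    and M :: "nat \<Rightarrow> 'a measure"
    and \<xi> :: "nat \<Rightarrow> nat \<Rightarrow> nat \<Rightarrow> nat \<Rightarrow> 'a \<Rightarrow> real"
    and x0 :: "nat \<Rightarrow> nat \<Rightarrow> real"
    and \<kappa> :: "nat \<Rightarrow> 'k::finite \<Rightarrow> nat"
    and t :: nat
  assumes law: "prob_space \<mu>" "sets \<mu> = sets borel"
    and eps_lim: "((\<lambda>x. eps_of \<mu> x) \<longlongrightarrow> 0) at_top"
    and delta_pos: "\<delta> > 0"
    and eps_bounds: "\<And>x. - ereal (1 / \<delta>) \<le> eps_of \<mu> x \<and> eps_of \<mu> x \<le> ereal (1 - \<delta>)"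
    and prob: "\<And>N. prob_space (M N)"
    and indep: "\<And>N. prob_space.indep_vars (M N) (\<lambda>_. borel) (\<lambda>(i, j, s). \<xi> N i j s)
                 ({1..N} \<times> {1..N} \<times> {1..})"
    and distr: "\<And>N i j s. i \<in> {1..N} \<Longrightarrow> j \<in> {1..N} \<Longrightarrow> s \<ge> 1 \<Longrightarrow>
                 distr (M N) borel (\<xi> N i j s) = \<mu>"
    and K: "\<And>N. N \<ge> CARD('k) \<Longrightarrow> inj (\<kappa> N) \<and> range (\<kappa> N) \<subseteq> {1..N}"
    and t: "t \<ge> 2"
  shows "conv_in_law M
           (\<lambda>N \<omega>. \<lambda>a. maxplus N (x0 N) (\<lambda>i j s. \<xi> N i j s \<omega>) t (\<kappa> N a)
                       - Phi N (maxplus N (x0 N) (\<lambda>i j s. \<xi> N i j s \<omega>) (t - 1)))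
           (Pi\<^sub>M UNIV (\<lambda>_. gumbel))
       \<and> (\<forall>e>0. ((\<lambda>N. measure (M N)
              {\<omega> \<in> space (M N). \<exists>x::real.
                 \<bar>U_emp N (maxplus N (x0 N) (\<lambda>i j s. \<xi> N i j s \<omega>) t)
                     (Phi N (maxplus N (x0 N) (\<lambda>i j s. \<xi> N i j s \<omega>) (t - 1)) + x)
                  - (1 - exp (- exp (- x)))\<bar> > e}) \<longlongrightarrow> 0) sequentially)"
proof -
  interpret rd: real_distribution \<mu>
    using law by (intro real_distribution.intro real_distribution_axioms.intro)
  interpret gumbel_tail \<mu> \<delta>
    by unfold_locales (use delta_pos eps_lim eps_bounds in auto)
  \<comment> \<open>The step to \<open>Suc s\<close> makes the weights small, the step to
    \<open>Suc (Suc s)\<close> produces the Gumbel law.\<close>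
  obtain s where s: "t = Suc (Suc s)"
    using t by (metis Suc_le_D numeral_2_eq_2 Suc_le_mono)
  have lp: "last_passage (M N) \<mu> N (\<xi> N)" if "N \<ge> 1" for N
    using that prob indep distr rd.real_distribution_axioms
    by (intro last_passage.intro last_passage_axioms.intro) auto
  let ?front = "\<lambda>N. last_passage.front N (x0 N) (\<xi> N)"
  let ?B = "\<lambda>N \<eta>. {v \<in> space (Pi\<^sub>M {1..N} (\<lambda>_. borel)). \<forall>j\<in>{1..N}. weight N v j \<le> \<eta>}"
  let ?p = "\<lambda>N \<eta>. measure (M N) {\<omega> \<in> space (M N). ?front N (Suc s) \<omega> \<notin> ?B N \<eta>}"
  have bad: "\<forall>\<^sub>F N in sequentially. N \<ge> 1 \<and> ?p N \<eta> \<le> e" if "\<eta> > 0" "e > 0" for \<eta> e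
    using weights_of_max_step_small[OF that] eventually_ge_at_top[of 1]
  proof eventually_elim
    case (elim N)
    interpret last_passage "M N" \<mu> N "x0 N" "\<xi> N" by (rule lp) fact
    show ?case
      using prob_weights_front_Suc[of \<eta> e s] elim that by auto
  qed
  show ?thesis
  proof (intro conjI allI impI)
    show "conv_in_law M
           (\<lambda>N \<omega>. \<lambda>a. maxplus N (x0 N) (\<lambda>i j s. \<xi> N i j s \<omega>) t (\<kappa> N a)
                       - Phi N (maxplus N (x0 N) (\<lambda>i j s. \<xi> N i j s \<omega>) (t - 1)))
           (Pi\<^sub>M UNIV (\<lambda>_. gumbel))"
      unfolding conv_in_law_def
    proof (intro allI impI, elim conjE)
      fix f :: "('k \<Rightarrow> real) \<Rightarrow> real"
      assume f: "continuous_on UNIV f" "bounded (range f)"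
      let ?c = "\<integral>y. f y \<partial>Pi\<^sub>M UNIV (\<lambda>_. gumbel)"
      obtain C0 where C0: "\<And>y. \<bar>f y\<bar> \<le> C0"
        using f(2) by (auto simp: bounded_iff)
      \<comment> \<open>The summand 1 makes \<open>C\<close> positive, so that it may be divided
        by.\<close>
      define C where "C = C0 + \<bar>?c\<bar> + 1"
      have C: "\<bar>f y - ?c\<bar> \<le> C" for y
        using C0[of y] unfolding C_def by linarith
      have C_pos: "C > 0"
        using C0[of undefined] unfolding C_def by linarith
      show "(\<lambda>N. \<integral>\<omega>. f (\<lambda>a. maxplus N (x0 N) (\<lambda>i j s. \<xi> N i j s \<omega>) t (\<kappa> N a)
          - Phi N (maxplus N (x0 N) (\<lambda>i j s. \<xi> N i j s \<omega>) (t - 1))) \<partial>M N) \<longlonglongrightarrow> ?c"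
      proof (rule tendstoI)
        fix e :: real assume e: "e > 0"
        obtain \<eta> where \<eta>: "\<eta> > 0"
          "\<And>N v \<kappa>. inj \<kappa> \<Longrightarrow> range \<kappa> \<subseteq> {1..N} \<Longrightarrow> \<forall>j\<in>{1..N}. weight N v j \<le> \<eta> \<Longrightarrow>
             \<bar>(\<integral>w. f (\<lambda>a. max_step N v w (\<kappa> a) - Phi N v) \<partial>noise \<mu> N) - ?c\<bar> < e / 2"
          using max_step_law_near_gumbel[OF f, of "e / 2"] e by auto
        \<comment> \<open>Bad fronts then cost at most \<open>e / 4\<close>, and
          \<open>e / 2 + e / 4 < e\<close>.\<close>
        have "e / (4 * C) > 0"
          using e C_pos by simp
        from bad[OF \<eta>(1) this] eventually_ge_at_top[of "CARD('k)"]
        show "\<forall>\<^sub>F N in sequentially. dist (\<integral>\<omega>. f (\<lambda>a. maxplus N (x0 N) (\<lambda>i j s. \<xi> N i j s \<omega>) t (\<kappa> N a)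
          - Phi N (maxplus N (x0 N) (\<lambda>i j s. \<xi> N i j s \<omega>) (t - 1))) \<partial>M N) ?c < e"
        proof eventually_elim
          case (elim N)
          interpret last_passage "M N" \<mu> N "x0 N" "\<xi> N" by (rule lp) (use elim in simp)
          have \<kappa>: "inj (\<kappa> N)" "range (\<kappa> N) \<subseteq> {1..N}"
            using K[of N] elim by auto
          have \<kappa>_in: "\<kappa> N a \<in> {1..N}" for a
            using \<kappa>(2) by blast
          have "\<bar>(\<integral>\<omega>. f (\<lambda>a. front (Suc (Suc s)) \<omega> (\<kappa> N a) - Phi N (front (Suc s) \<omega>)) \<partial>M N) - ?c\<bar>
            \<le> e / 2 + C * ?p N \<eta>"
            by (rule expectation_front_step[OF f(1) C \<kappa>(2) weights_le_sets less_imp_le])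
               (use \<eta>(2)[OF \<kappa>] e in auto)
          also have "C * ?p N \<eta> \<le> C * (e / (4 * C))"
            using elim C_pos by (intro mult_left_mono) auto
          also have "e / 2 + C * (e / (4 * C)) < e"
            using C_pos e by simp
          finally show ?case
            by (simp add: dist_real_def s maxplus_eq_front front_eq[OF \<kappa>_in])
        qed
      qed
    qed
  next
    fix e :: real assume e: "e > 0"
    obtain G where G: "finite G"
      "\<And>U x. antimono U \<Longrightarrow> (\<And>y. 0 \<le> U y \<and> U y \<le> 1) \<Longrightarrow>
         (\<And>g. g \<in> G \<Longrightarrow> \<bar>U g - (1 - exp (- exp (- g)))\<bar> \<le> e / 2) \<Longrightarrow>
         \<bar>U x - (1 - exp (- exp (- x)))\<bar> \<le> e"
      using antimono_near_gumbel_tail[OF e] by metis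
    \<comment> \<open>The bad events at grid points only; a union bound over the finite set
      \<open>G\<close> will cover all \<open>x\<close>.\<close>
    define A where "A N g = {\<omega> \<in> space (M N).
      \<bar>U_emp N (?front N t \<omega>) (Phi N (?front N (t - 1) \<omega>) + g) - (1 - exp (- exp (- g)))\<bar> > e / 2}" for N g
    have "(\<lambda>N. measure (M N) (A N g)) \<longlonglongrightarrow> 0" for g
    proof (rule tendstoI)
      fix r :: real assume r: "r > 0"
      obtain \<eta> where \<eta>: "\<eta> > 0"
        "\<And>e'. e' > 0 \<Longrightarrow> \<forall>\<^sub>F N in sequentially. \<forall>v. (\<forall>j\<in>{1..N}. weight N v j \<le> \<eta>) \<longrightarrow>
           measure (noise \<mu> N) {w \<in> space (noise \<mu> N).
             \<bar>U_emp N (max_step N v w) (Phi N v + g) - (1 - exp (- exp (- g)))\<bar> > e / 2} \<le> e'"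
        using U_emp_max_step_near_gumbel[of "e / 2" g] e by auto
      \<comment> \<open>One third for the step from a good front, one third for a bad front; the
        last third makes the inequality strict.\<close>
      have r3: "r / 3 > 0" using r by simp
      from bad[OF \<eta>(1) r3] \<eta>(2)[OF r3]
      show "\<forall>\<^sub>F N in sequentially. dist (measure (M N) (A N g)) 0 < r"
      proof eventually_elim
        case (elim N)
        interpret last_passage "M N" \<mu> N "x0 N" "\<xi> N" by (rule lp) (use elim in simp)
        have "measure (M N) (A N g) \<le> r / 3 + ?p N \<eta>"
          unfolding A_def s diff_Suc_1
          by (rule prob_U_emp_front_step[OF weights_le_sets]) (use elim r in auto)
        then show ?case
          using elim r by (simp add: dist_real_def)
      qed
    qed
    then have lim: "(\<lambda>N. \<Sum>g\<in>G. measure (M N) (A N g)) \<longlonglongrightarrow> 0"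
      by (intro tendsto_null_sum)
    show "((\<lambda>N. measure (M N)
              {\<omega> \<in> space (M N). \<exists>x::real.
                 \<bar>U_emp N (maxplus N (x0 N) (\<lambda>i j s. \<xi> N i j s \<omega>) t)
                     (Phi N (maxplus N (x0 N) (\<lambda>i j s. \<xi> N i j s \<omega>) (t - 1)) + x)
                  - (1 - exp (- exp (- x)))\<bar> > e}) \<longlongrightarrow> 0) sequentially"
    proof (rule tendsto_sandwich[OF _ _ tendsto_const lim])
      show "\<forall>\<^sub>F N in sequentially. measure (M N)
              {\<omega> \<in> space (M N). \<exists>x::real.
                 \<bar>U_emp N (maxplus N (x0 N) (\<lambda>i j s. \<xi> N i j s \<omega>) t)
                     (Phi N (maxplus N (x0 N) (\<lambda>i j s. \<xi> N i j s \<omega>) (t - 1)) + x)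
                  - (1 - exp (- exp (- x)))\<bar> > e} \<le> (\<Sum>g\<in>G. measure (M N) (A N g))"
        using eventually_ge_at_top[of 1]
      proof eventually_elim
        case (elim N)
        interpret last_passage "M N" \<mu> N "x0 N" "\<xi> N" by (rule lp) fact
        have A: "A N g \<in> sets (M N)" for g
          unfolding A_def using U_emp_front_measurable[of t "t - 1" g]
          by (intro borel_measurable_less borel_measurable_abs borel_measurable_diff) auto
        have "{\<omega> \<in> space (M N). \<exists>x::real.
                 \<bar>U_emp N (maxplus N (x0 N) (\<lambda>i j s. \<xi> N i j s \<omega>) t)
                     (Phi N (maxplus N (x0 N) (\<lambda>i j s. \<xi> N i j s \<omega>) (t - 1)) + x)
                  - (1 - exp (- exp (- x)))\<bar> > e} \<subseteq> (\<Union>g\<in>G. A N g)"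
        proof (rule subsetI, rule ccontr)
          fix \<omega>
          assume "\<omega> \<in> {\<omega> \<in> space (M N). \<exists>x::real.
                 \<bar>U_emp N (maxplus N (x0 N) (\<lambda>i j s. \<xi> N i j s \<omega>) t)
                     (Phi N (maxplus N (x0 N) (\<lambda>i j s. \<xi> N i j s \<omega>) (t - 1)) + x)
                  - (1 - exp (- exp (- x)))\<bar> > e}"
          then obtain x where \<omega>: "\<omega> \<in> space (M N)" and
            x: "\<bar>U_emp N (front t \<omega>) (Phi N (front (t - 1) \<omega>) + x) - (1 - exp (- exp (- x)))\<bar> > e"
            by (auto simp only: maxplus_eq_front mem_Collect_eq)
          assume "\<omega> \<notin> (\<Union>g\<in>G. A N g)"
          then have grid: "\<bar>U_emp N (front t \<omega>) (Phi N (front (t - 1) \<omega>) + g) - (1 - exp (- exp (- g)))\<bar> \<le> e / 2"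
            if "g \<in> G" for g
            using \<omega> that unfolding A_def by (simp add: not_less)
          have "\<bar>U_emp N (front t \<omega>) (Phi N (front (t - 1) \<omega>) + x) - (1 - exp (- exp (- x)))\<bar> \<le> e"
            by (rule G(2)[OF U_emp_antimono]) (use U_emp_bounds grid in blast)+
          then show False
            using x by linarith
        qed
        \<comment> \<open>The event quantifies over uncountably many \<open>x\<close>; measurability
          is shown for the finite union that contains it.\<close>
        then have "measure (M N) {\<omega> \<in> space (M N). \<exists>x::real.
                 \<bar>U_emp N (maxplus N (x0 N) (\<lambda>i j s. \<xi> N i j s \<omega>) t)
                     (Phi N (maxplus N (x0 N) (\<lambda>i j s. \<xi> N i j s \<omega>) (t - 1)) + x)
                  - (1 - exp (- exp (- x)))\<bar> > e} \<le> measure (M N) (\<Union>g\<in>G. A N g)"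
          using A G(1) by (intro finite_measure_mono sets.finite_UN) auto
        also have "\<dots> \<le> (\<Sum>g\<in>G. measure (M N) (A N g))"
          using A G(1) by (intro measure_UNION_le) auto
        finally show ?case .
      qed
    qed simp
  qed
qed

end
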